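(* For generic $a\in\mathbb{C}^*$ (so that all terms are defined), $$\Big(1+\frac1a\Big)\sum_{n=0}^{\infty}\frac{(aq;q^2)_n(q/a;q^2)_n\,q^{2n+1}}{(-q;q)_{2n+1}}=2m(a,q^2,-1)-\frac{j(aq;q^2)}{j(-q;q^4)}\,m(a,q,-1)-\frac12\frac{J_1^5}{J_2^4}\frac{j(aq;q^2)}{j(-a;q)}.$$
   Context: $q$ is a complex number with $0<|q|<1$. $(x;q)_n=\prod_{i=0}^{n-1}(1-xq^i)$, $(x;q)_\infty=\prod_{i\ge0}(1-xq^i)$, $j(x;q)=(x;q)_\infty(q/x;q)_\infty(q;q)_\infty$, and $J_m=(q^m;q^m)_\infty$. The Appell--Lerch sum is $m(x,q,z)=\frac{1}{j(z;q)}\sum_{r\in\mathbb{Z}}\frac{(-1)^rq^{\binom r2}z^r}{1-q^{r-1}xz}$. *)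

theory Defs
  imports "HOL-Analysis.Analysis"
begin

definition qpoch :: "complex \<Rightarrow> complex \<Rightarrow> nat \<Rightarrow> complex" where
  "qpoch x q n = (\<Prod>i<n. 1 - x * q ^ i)"

(* The library's prodinf allows finitely many zero factors, so this is 0 (not undefined)
   when x = q ^ (-i) for some i. *)
definition qpoch_inf :: "complex \<Rightarrow> complex \<Rightarrow> complex" where
  "qpoch_inf x q = (\<Prod>i. 1 - x * q ^ i)"

definition theta_j :: "complex \<Rightarrow> complex \<Rightarrow> complex" where
  "theta_j x q = qpoch_inf x q * qpoch_inf (q / x) q * qpoch_inf q q"

definition J :: "complex \<Rightarrow> nat \<Rightarrow> complex" where
  "J q m = qpoch_inf (q ^ m) (q ^ m)"

(* The sum is unordered (absolutely convergent for 0 < norm q < 1); r * (r - 1) div 2 is the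
   binomial coefficient "r choose 2" for an integer r, the division being exact.
   Defined only if z is not an integer power of q and no denominator vanishes. *)
definition appell_lerch_m :: "complex \<Rightarrow> complex \<Rightarrow> complex \<Rightarrow> complex" where
  "appell_lerch_m x q z =
     1 / theta_j z q *
     (\<Sum>\<^sub>\<infinity>r\<in>(UNIV :: int set).
        (-1) powi r * q powi (r * (r - 1) div 2) * z powi r / (1 - q powi (r - 1) * x * z))"

end

theory Submission
  imports Defs "HOL-Complex_Analysis.Complex_Analysis"
begin

text \<open>
  Both sides satisfy the inhomogeneous equation
  \<open>f(q\<^sup>2a) + a f(a) = 2 + (1/(aq) - 1) j(aq;q\<^sup>2) / j(-q;q\<^sup>4)\<close>: on the left the partial sums
  of \<open>f(q\<^sup>2a) + a f(a)\<close> telescope, on the right this is the shift equation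
  \<open>m(qx,q,-1) = 1 - x m(x,q,-1)\<close>, whose constant is Gauss's value of the sum of
  \<open>q\<^bsup>r(r-1)/2\<^esup>\<close>. The residues of the right-hand side at \<open>-1\<close> and \<open>-q\<close> cancel, and
  by the shift equation those at all \<open>-q\<^sup>k\<close> do, so the difference \<open>D\<close> of the two sides is
  holomorphic on the punctured plane with \<open>D(q\<^sup>2a) = -a D(a)\<close>. This forces \<open>D\<close> to be bounded,
  hence constant by Liouville's theorem, hence zero.
\<close>

subsection \<open>Infinite products\<close>

text \<open>The equation f(q^2 a) = -f(a)/a has the solution j(a;q^2), which is holomorphic on the
  punctured plane. The equation for D has the reciprocal factor, so its nonzero solutions are of the
  type 1/j and cannot be holomorphic there; this is why the proof comes down to pole cancellation.
  The last term of the right-hand side, a multiple of j(aq;q^2)/j(-a;q), solves the homogeneous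
  equation itself. Its coefficient is therefore invisible to the shift equation and is fixed by the
  poles alone. At -q^k with k odd only m(a,q,-1) and this quotient are singular; with k even
  m(a,q^2,-1) is singular as well. The single coefficient must meet both conditions, and they are
  compared by writing the theta constants as quotients of J_1, J_2, J_4. An obstacle is that
  division by zero yields 0, so \<open>mock_diff\<close> has accidental values at -q^k. Statements
  about these points are about limits through punctured neighbourhoods, and
  \<open>remove_sings\<close> puts in the limits at the end.\<close>

lemma qpoch_0 [simp]: "qpoch x q 0 = 1"
  by (simp add: qpoch_def)

lemma qpoch_Suc: "qpoch x q (Suc n) = qpoch x q n * (1 - x * q ^ n)"
  by (simp add: qpoch_def)

lemma qpoch_Suc_left: "qpoch x q (Suc n) = (1 - x) * qpoch (x * q) q n"
  unfolding qpoch_def by (subst prod.lessThan_Suc_shift) (simp add: mult_ac)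

lemma norm_power_neq_1:
  fixes q :: complex
  assumes "norm q < 1" "n > 0"
  shows "q ^ n \<noteq> 1"
  using assms by (metis norm_one norm_power less_irrefl norm_ge_zero power_less_one_iff)

lemma convergent_prod_qpoch:
  fixes x q :: complex
  assumes "norm q < 1"
  shows "convergent_prod (\<lambda>i. 1 - x * q ^ i)"
proof -
  have "summable (\<lambda>i. norm (1 - x * q ^ i - 1))"
    using summable_mult[OF summable_geometric[of "norm q"], of "norm x"] assms
    by (simp add: norm_mult norm_power)
  thus ?thesis
    by (intro abs_convergent_prod_imp_convergent_prod) (simp add: abs_convergent_prod_conv_summable)
qed

lemma qpoch_LIMSEQ:
  assumes "norm q < 1"
  shows "(\<lambda>n. qpoch x q n) \<longlonglongrightarrow> qpoch_inf x q"
  using convergent_prod_LIMSEQ[OF convergent_prod_qpoch[OF assms, of x]]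
  unfolding qpoch_def qpoch_inf_def by (simp add: LIMSEQ_lessThan_iff_atMost)

lemma qpoch_inf_step:
  assumes "norm q < 1"
  shows "qpoch_inf x q = (1 - x) * qpoch_inf (x * q) q"
proof (rule LIMSEQ_unique)
  show "(\<lambda>n. qpoch x q (Suc n)) \<longlonglongrightarrow> qpoch_inf x q"
    using qpoch_LIMSEQ[OF assms] by (rule LIMSEQ_Suc)
  show "(\<lambda>n. qpoch x q (Suc n)) \<longlonglongrightarrow> (1 - x) * qpoch_inf (x * q) q"
    unfolding qpoch_Suc_left by (intro tendsto_intros qpoch_LIMSEQ assms)
qed

lemma qpoch_inf_nonzero:
  assumes "norm q < 1" "\<And>i. x * q ^ i \<noteq> 1"
  shows "qpoch_inf x q \<noteq> 0"
  unfolding qpoch_inf_def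
  by (rule prodinf_nonzero[OF convergent_prod_qpoch]) (use assms in auto)

lemma qpoch_inf_nonzero':
  assumes "norm q < 1" "norm x < 1"
  shows "qpoch_inf x q \<noteq> 0"
proof (rule qpoch_inf_nonzero)
  fix i
  have "norm (x * q ^ i) \<le> norm x * 1"
    unfolding norm_mult norm_power using assms by (intro mult_left_mono power_le_one) auto
  thus "x * q ^ i \<noteq> 1"
    using assms by (metis less_irrefl mult.right_neutral norm_one order.strict_trans1)
qed fact

lemma qpoch_inf_mult_minus:
  assumes "norm q < 1"
  shows "qpoch_inf x q * qpoch_inf (- x) q = qpoch_inf (x\<^sup>2) (q\<^sup>2)"
  unfolding qpoch_inf_def
proof (subst prodinf_mult)
  show "(\<Prod>i. (1 - x * q ^ i) * (1 - - x * q ^ i)) = (\<Prod>i. 1 - x\<^sup>2 * q\<^sup>2 ^ i)"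
  proof (rule prodinf_cong)
    fix i
    have "q\<^sup>2 ^ i = q ^ i * q ^ i"
      by (simp add: power2_eq_square power_mult_distrib)
    thus "(1 - x * q ^ i) * (1 - - x * q ^ i) = 1 - x\<^sup>2 * q\<^sup>2 ^ i"
      by (simp add: algebra_simps power2_eq_square)
  qed
qed (rule convergent_prod_qpoch[OF assms])+

lemma qpoch_bisect: "qpoch x q (2 * n) = qpoch x (q\<^sup>2) n * qpoch (x * q) (q\<^sup>2) n"
proof (induction n)
  case (Suc n)
  have "q\<^sup>2 ^ n = q ^ (2 * n)"
    by (simp add: power_mult)
  with Suc show ?case
    by (simp add: qpoch_Suc mult_ac)
qed simp

lemma qpoch_inf_bisect:
  assumes "norm q < 1"
  shows "qpoch_inf x q = qpoch_inf x (q\<^sup>2) * qpoch_inf (x * q) (q\<^sup>2)"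
proof (rule LIMSEQ_unique)
  have q2: "norm (q\<^sup>2) < 1"
    using assms by (simp add: norm_power power_less_one_iff)
  show "(\<lambda>n. qpoch x q (2 * n)) \<longlonglongrightarrow> qpoch_inf x q"
    using LIMSEQ_subseq_LIMSEQ[OF qpoch_LIMSEQ[OF assms], of "\<lambda>n. 2 * n" x]
    by (simp add: o_def strict_mono_def)
  show "(\<lambda>n. qpoch x q (2 * n)) \<longlonglongrightarrow> qpoch_inf x (q\<^sup>2) * qpoch_inf (x * q) (q\<^sup>2)"
    unfolding qpoch_bisect by (intro tendsto_intros qpoch_LIMSEQ q2)
qed

section \<open>Holomorphy and growth of the products in their first argument\<close>

lemma qpoch_holomorphic: "(\<lambda>x. qpoch x q n) holomorphic_on A"
  unfolding qpoch_def by (intro holomorphic_intros)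

lemma holomorphic_uniform_sequence_cball:
  assumes "\<And>n::nat. f n holomorphic_on cball z r"
    and "uniform_limit (cball z r) f g sequentially"
  shows "g holomorphic_on ball z r"
proof -
  have *: "\<forall>\<^sub>F n in sequentially. continuous_on (cball z r) (f n) \<and> f n holomorphic_on ball z r"
    using holomorphic_on_imp_continuous_on[OF assms(1)]
          holomorphic_on_subset[OF assms(1) ball_subset_cball] by simp
  from holomorphic_uniform_limit[OF * assms(2)] show ?thesis
    by auto
qed

text \<open>The majorant \<open>r * norm q ^ n\<close> depends on the radius, so uniform convergence
  is obtained on bounded sets and the plane is exhausted by balls about 0.\<close>

lemma qpoch_inf_holomorphic_UNIV:
  assumes "norm q < 1"
  shows "(\<lambda>x. qpoch_inf x q) holomorphic_on UNIV"
proof -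
  have "(\<lambda>x. qpoch_inf x q) holomorphic_on ball 0 r" for r :: real
  proof (rule holomorphic_uniform_sequence_cball)
    have "uniformly_convergent_on (cball 0 r) (\<lambda>n x. qpoch x q n)"
      unfolding qpoch_def
    proof (rule uniformly_convergent_on_prod')
      show "uniformly_convergent_on (cball 0 r) (\<lambda>N x. \<Sum>n<N. norm (1 - x * q ^ n - 1))"
      proof (rule Weierstrass_m_test')
        show "norm (norm (1 - x * q ^ n - 1)) \<le> r * norm q ^ n" if "x \<in> cball 0 r" for x n
          using that by (auto simp: norm_mult norm_power intro: mult_right_mono)
        show "summable (\<lambda>n. r * norm q ^ n)"
          using assms by (intro summable_mult summable_geometric) auto
      qed
    qed (auto intro!: continuous_intros)
    thus "uniform_limit (cball 0 r) (\<lambda>n x. qpoch x q n) (\<lambda>x. qpoch_inf x q) sequentially"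
      by (simp add: uniformly_convergent_uniform_limit_iff limI[OF qpoch_LIMSEQ[OF assms]])
  qed (rule qpoch_holomorphic)
  hence "(\<lambda>x. qpoch_inf x q) analytic_on ball 0 r" for r :: real
    by (simp add: analytic_on_open)
  hence "(\<lambda>x. qpoch_inf x q) analytic_on {x}" for x
    by (rule analytic_on_subset[of _ "ball 0 (norm x + 1)"]) auto
  thus ?thesis
    using analytic_imp_holomorphic analytic_on_analytic_at by blast
qed

text \<open>The inequality 1 + t <= exp t turns the product into a geometric series in the exponent.
  The bound is independent of \<open>n\<close>, so one majorant serves the numerators of all
  \<open>mock_term\<close>.\<close>

lemma norm_qpoch_le:
  assumes "norm q < 1"
  shows "norm (qpoch x q n) \<le> exp (norm x / (1 - norm q))"
proof -
  have "norm (qpoch x q n) \<le> (\<Prod>i<n. exp (norm x * norm q ^ i))"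
    unfolding qpoch_def prod_norm [symmetric]
  proof (rule prod_mono, safe)
    fix i
    have "norm (1 - x * q ^ i) \<le> 1 + norm x * norm q ^ i"
      using norm_triangle_ineq4[of 1 "x * q ^ i"] by (simp add: norm_mult norm_power)
    also have "\<dots> \<le> exp (norm x * norm q ^ i)"
      by (rule exp_ge_add_one_self)
    finally show "norm (1 - x * q ^ i) \<le> exp (norm x * norm q ^ i)" .
  qed auto
  also have "\<dots> = exp (norm x * (\<Sum>i<n. norm q ^ i))"
    by (simp add: exp_sum sum_distrib_left)
  also have "(\<Sum>i<n. norm q ^ i) \<le> (\<Sum>i. norm q ^ i)"
    using assms by (intro sum_le_suminf summable_geometric) auto
  also have "(\<Sum>i. norm q ^ i) = 1 / (1 - norm q)"
    using assms by (intro suminf_geometric) auto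
  finally show ?thesis
    by (simp add: mult_left_mono)
qed

section \<open>Quasi-periodicity and zeros of the theta function\<close>

lemma theta_j_shift:
  assumes "0 < norm q" "norm q < 1" "x \<noteq> 0"
  shows "theta_j (q * x) q = - theta_j x q / x"
proof -
  have q0: "q \<noteq> 0" using assms by auto
  have 1: "qpoch_inf (1 / x) q = (1 - 1 / x) * qpoch_inf (q / x) q"
    using qpoch_inf_step[OF assms(2), of "1 / x"] by simp
  have 2: "qpoch_inf x q = (1 - x) * qpoch_inf (q * x) q"
    using qpoch_inf_step[OF assms(2), of x] by (simp add: mult_ac)
  have 3: "q / (q * x) = 1 / x" using q0 by simp
  \<comment> \<open>Passing from x to qx removes 1 - x from the first product and adds 1 - 1/x to
    the second, and (1 - 1/x) = -(1 - x)/x. Nothing is divided by 1 - x, so x = 1 is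
    covered.\<close>
  show ?thesis
    unfolding theta_j_def 1 2 3 using assms by (simp add: field_simps)
qed

lemma theta_j_nonzero:
  assumes q: "0 < norm q" "norm q < 1" and "x \<noteq> 0" "\<And>k::int. x \<noteq> q powi k"
  shows "theta_j x q \<noteq> 0"
proof -
  have q0: "q \<noteq> 0" using q by auto
  have "x * q ^ i \<noteq> 1" for i
    using assms(4)[of "- int i"] q0 by (auto simp: power_int_minus field_simps)
  moreover have "q / x * q ^ i \<noteq> 1" for i
    using assms(4)[of "int (Suc i)"] \<open>x \<noteq> 0\<close> by (auto simp: field_simps simp del: of_nat_Suc)
  moreover have "q * q ^ i \<noteq> 1" for i
    using norm_power_neq_1[OF q(2), of "Suc i"] by simp
  ultimately show ?thesis
    unfolding theta_j_def using qpoch_inf_nonzero[OF q(2)] by simp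
qed

subsection \<open>Gauss's triangular number series\<close>

lemma two_times_choose_two_int: "2 * (r * (r - 1) div 2) = r * (r - 1)" for r :: int
  by (rule dvd_mult_div_cancel) simp

text \<open>This turns a factor \<open>q powi (r - 1)\<close>, the one in the denominators of the
  Appell-Lerch sum, into an index shift of the Gaussian exponent.\<close>

lemma choose_two_int_diff_1: "r * (r - 1) div 2 = (r - 1) * (r - 1 - 1) div 2 + (r - 1)" for r :: int
proof -
  have "2 * (r * (r - 1) div 2) = 2 * ((r - 1) * (r - 1 - 1) div 2 + (r - 1))"
    unfolding distrib_left two_times_choose_two_int by (simp add: algebra_simps)
  thus ?thesis by simp
qed

lemma power_int_triangular:
  fixes q :: "'a :: field"
  shows "q powi ((int n + 1) * (int n + 1 - 1) div 2) = q ^ (n * Suc n div 2)"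
    and "q powi (- int n * (- int n - 1) div 2) = q ^ (n * Suc n div 2)"
proof -
  have "(int n + 1) * (int n + 1 - 1) div 2 = int (n * Suc n div 2)"
    by (simp add: zdiv_int algebra_simps)
  moreover have "- int n * (- int n - 1) div 2 = int (n * Suc n div 2)"
    by (simp add: zdiv_int algebra_simps)
  ultimately show "q powi ((int n + 1) * (int n + 1 - 1) div 2) = q ^ (n * Suc n div 2)"
    and "q powi (- int n * (- int n - 1) div 2) = q ^ (n * Suc n div 2)"
    by (simp_all only: power_int_of_nat)
qed

lemma summable_norm_power_triangular:
  fixes q :: "'a :: {real_normed_field}"
  assumes "norm q < 1"
  shows "summable (\<lambda>n. norm (q ^ (n * Suc n div 2)))"
proof (rule summable_comparison_test')
  show "summable (\<lambda>n. norm q ^ n)"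
    using assms by (intro summable_geometric) auto
  fix n :: nat
  have "2 * n \<le> n * Suc n"
    by (cases n) auto
  hence "n \<le> n * Suc n div 2"
    by linarith
  thus "norm (norm (q ^ (n * Suc n div 2))) \<le> norm q ^ n"
    using assms by (auto simp: norm_power intro!: power_decreasing)
qed

text \<open>The exponent is invariant under r -> 1 - r, so the positive and the nonpositive integers
  each run through the triangular numbers; hence the factor 2.\<close>

lemma has_sum_power_choose_two_int:
  fixes q :: "'a :: {real_normed_field, banach}"
  assumes "norm q < 1"
  shows "((\<lambda>r::int. q powi (r * (r - 1) div 2)) has_sum (2 * (\<Sum>n. q ^ (n * Suc n div 2)))) UNIV"
proof -
  let ?f = "\<lambda>r::int. q powi (r * (r - 1) div 2)"
  let ?S = "\<Sum>n. q ^ (n * Suc n div 2)"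
  have S: "((\<lambda>n. q ^ (n * Suc n div 2)) has_sum ?S) UNIV"
    using summable_norm_power_triangular[OF assms] summable_sums[OF summable_norm_cancel]
    by (rule norm_summable_imp_has_sum) (rule summable_norm_power_triangular[OF assms])
  have 1: "(?f has_sum ?S) (range (\<lambda>n. int n + 1))"
    using S by (subst has_sum_reindex) (auto simp only: inj_on_def o_def power_int_triangular(1))
  have 2: "(?f has_sum ?S) (range (\<lambda>n. - int n))"
    using S by (subst has_sum_reindex) (auto simp only: inj_on_def o_def power_int_triangular(2))
  have un: "range (\<lambda>n. int n + 1) \<union> range (\<lambda>n. - int n) = UNIV"
  proof (intro equalityI subsetI UNIV_I)
    fix r :: int
    show "r \<in> range (\<lambda>n. int n + 1) \<union> range (\<lambda>n. - int n)"
    proof (cases "r > 0")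
      case True
      hence "r = int (nat (r - 1)) + 1" by simp
      thus ?thesis by blast
    next
      case False
      hence "r = - int (nat (- r))" by simp
      thus ?thesis by blast
    qed
  qed
  have "(?f has_sum (?S + ?S)) (range (\<lambda>n. int n + 1) \<union> range (\<lambda>n. - int n))"
    by (intro has_sum_Un_disjoint 1 2) auto
  thus ?thesis
    unfolding un mult_2 .
qed

text \<open>Shanks' finite form of Gauss's formula for the sum of \<open>q\<^bsup>n(n+1)/2\<^esup>\<close>;
  the increment in \<open>n\<close> telescopes in the summation variable on the right.\<close>

lemma shanks_identity:
  fixes q :: "'a :: field" and P :: "nat \<Rightarrow> 'a"
  assumes nz: "\<And>n. q ^ Suc n \<noteq> 1"
    and P0: "P 0 = 1"
    and PS: "\<And>n. P (Suc n) = P n * (1 - q ^ (2 * n + 2)) / (1 - q ^ (2 * n + 1))"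
  shows "(\<Sum>k<2*n. q ^ (k * Suc k div 2)) = P n * (\<Sum>s<n. q ^ (s * (2 * n + 1)) / P s)"
proof (induction n)
  case 0
  show ?case by simp
next
  case (Suc n)
  have nz': "1 - q ^ (2 * m + 2) \<noteq> 0" "1 - q ^ (2 * m + 1) \<noteq> 0" for m
    using nz[of "2 * m + 1"] nz[of "2 * m"] by simp_all
  have P_nz: "P m \<noteq> 0" for m
  proof (induction m)
    case (Suc m)
    thus ?case unfolding PS using nz'[of m] by (simp del: power_Suc)
  qed (simp add: P0)
  \<comment> \<open>\<open>W m\<close> is the closed form, shown in \<open>tel\<close>, of the sum
    over s <= m of the weighted summand for \<open>Suc n\<close> minus that for \<open>n\<close>.
    The weights are the numerator and the denominator of P (Suc n) / P n.\<close>
  define W where "W = (\<lambda>s. q ^ (Suc s * (2 * n + 1)) * (1 - q ^ (2 * s + 1)) / P s)"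
  have tel: "(\<Sum>s<Suc m. q ^ (s * (2 * n + 3)) * (1 - q ^ (2 * n + 2)) / P s
                    - q ^ (s * (2 * n + 1)) * (1 - q ^ (2 * n + 1)) / P s) = W m" for m
  proof (induction m)
    case 0
    show ?case by (simp add: W_def P0 algebra_simps power_add)
  next
    case (Suc m)
    define x y where "x = q ^ (Suc m * (2 * n + 1))" and "y = q ^ (2 * m + 1)"
    define c where "c = q ^ (2 * n + 1)"
    have e1: "q ^ (Suc m * (2 * n + 3)) = x * y * q"
    proof -
      have "Suc m * (2 * n + 3) = Suc m * (2 * n + 1) + (2 * m + 1) + 1"
        by (simp add: algebra_simps)
      thus ?thesis unfolding x_def y_def by (simp only: power_add power_one_right)
    qed
    have e2: "q ^ (2 * n + 2) = c * q" by (simp add: c_def)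
    have e3: "q ^ (2 * Suc m + 1) = y * q ^ 2"
      unfolding y_def power_add[symmetric] by simp
    have e4: "q ^ (Suc (Suc m) * (2 * n + 1)) = x * c"
      unfolding x_def c_def power_add[symmetric] by (simp add: algebra_simps)
    have y1: "1 - y * q \<noteq> 0" "1 - y \<noteq> 0"
      using nz'[of m] by (simp_all add: y_def mult_ac)
    have e5': "q ^ (2 * m + 2) = y * q" by (simp add: y_def)
    have "P (Suc m) = P m * (1 - y * q) / (1 - y)"
      unfolding PS by (simp only: e5' y_def)
    hence e5: "P m = P (Suc m) * (1 - y) / (1 - y * q)"
      using y1 by (simp add: field_simps)
    have W: "W m = x * (1 - y * q) / P (Suc m)" "W (Suc m) = x * c * (1 - y * q\<^sup>2) / P (Suc m)"
      unfolding W_def e3 e4 e5 x_def[symmetric] y_def[symmetric] using y1 P_nz[of "Suc m"] by simp_all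
    have "(\<Sum>s<Suc (Suc m). q ^ (s * (2 * n + 3)) * (1 - q ^ (2 * n + 2)) / P s
                    - q ^ (s * (2 * n + 1)) * (1 - q ^ (2 * n + 1)) / P s)
        = W m + (x * y * q * (1 - c * q) / P (Suc m) - x * (1 - c) / P (Suc m))"
      by (subst sum.lessThan_Suc, subst Suc.IH) (simp only: e1 e2 x_def[symmetric] c_def[symmetric])
    also have "\<dots> = (x * (1 - y * q) + x * y * q * (1 - c * q) - x * (1 - c)) / P (Suc m)"
      unfolding W by (simp add: add_divide_distrib diff_divide_distrib)
    also have "x * (1 - y * q) + x * y * q * (1 - c * q) - x * (1 - c) = x * c * (1 - y * q\<^sup>2)"
      by (simp add: algebra_simps power2_eq_square)
    finally show ?case unfolding W .
  qed
  define A where "A = (\<Sum>s<Suc n. q ^ (s * (2 * n + 3)) / P s)"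
  define B where "B = (\<Sum>s<n. q ^ (s * (2 * n + 1)) / P s)"
  define c where "c = q ^ (2 * n + 1)"
  define t where "t = q ^ (n * (2 * n + 1))"
  have c: "1 - c \<noteq> 0" using nz'[of n] by (simp add: c_def)
  \<comment> \<open>The sum for \<open>n\<close> has one term less than that for
    \<open>Suc n\<close>. The missing term \<open>t / P n\<close> produces the triangular power with
    index 2n, and \<open>W n\<close> the one with index 2n + 1.\<close>
  have Bt: "B + t / P n = (\<Sum>s<Suc n. q ^ (s * (2 * n + 1)) / P s)"
    by (simp only: B_def t_def sum.lessThan_Suc)
  have "A * (1 - q ^ (2 * n + 2)) - (B + t / P n) * (1 - c) = W n"
    using tel[of n] unfolding Bt A_def c_def sum_subtractf sum_distrib_right
    by (simp only: times_divide_eq_left)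
  also have "W n = t * c * (1 - c) / P n"
    unfolding W_def t_def c_def power_add[symmetric] by (simp add: algebra_simps)
  finally have "P n * (A * (1 - q ^ (2 * n + 2)) - (B + t / P n) * (1 - c)) = t * c * (1 - c)"
    using P_nz[of n] by simp
  moreover have *: "P n * A * d = P n * (A * d - (B + u) * (1 - c)) + (P n * B + P n * u) * (1 - c)" for d u
    by (simp add: algebra_simps)
  moreover have "P n * (t / P n) = t"
    using P_nz[of n] by simp
  ultimately have "P n * A * (1 - q ^ (2 * n + 2)) = t * c * (1 - c) + (P n * B + t) * (1 - c)"
    unfolding *[of "1 - q ^ (2 * n + 2)" "t / P n"] by (simp only:)
  hence "P n * A * (1 - q ^ (2 * n + 2)) = (P n * B + t + t * c) * (1 - c)"
    by (simp add: algebra_simps)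
  hence *: "P (Suc n) * A = P n * B + t + t * c"
    unfolding PS c_def[symmetric] using c by (simp add: field_simps)
  have d: "2 * n * Suc (2 * n) div 2 = n * (2 * n + 1)"
          "Suc (2 * n) * Suc (Suc (2 * n)) div 2 = n * (2 * n + 1) + (2 * n + 1)"
  proof -
    have "2 * n * Suc (2 * n) = 2 * (n * (2 * n + 1))" by simp
    thus "2 * n * Suc (2 * n) div 2 = n * (2 * n + 1)"
      by (simp only: nonzero_mult_div_cancel_left[OF zero_neq_numeral[symmetric]])
    have "Suc (2 * n) * Suc (Suc (2 * n)) = 2 * (n * (2 * n + 1) + (2 * n + 1))"
      by (simp add: algebra_simps)
    thus "Suc (2 * n) * Suc (Suc (2 * n)) div 2 = n * (2 * n + 1) + (2 * n + 1)"
      by (simp only: nonzero_mult_div_cancel_left[OF zero_neq_numeral[symmetric]])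
  qed
  have "(\<Sum>k<2 * Suc n. q ^ (k * Suc k div 2))
      = (\<Sum>k<2*n. q ^ (k * Suc k div 2)) + t + t * c"
    using d by (simp only: mult_Suc_right add_2_eq_Suc sum.lessThan_Suc power_add t_def c_def)
  also have "\<dots> = P (Suc n) * A"
    unfolding * Suc B_def by simp
  finally have "(\<Sum>k<2 * Suc n. q ^ (k * Suc k div 2)) = P (Suc n) * A" .
  moreover have "2 * n + 3 = 2 * Suc n + 1" by simp
  ultimately show ?case
    by (simp only: A_def)
qed

text \<open>In the limit of Shanks' formula only the term s = 0 survives, which leaves the product
  \<open>P'\<close>. Euler's identity (-q;q)_inf (q;q^2)_inf = 1, here \<open>e3\<close>, rewrites
  it as a theta constant. This is the normalisation of m(x,q,-1), so the shift equation gets the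
  constant 1.\<close>

lemma gauss_triangular:
  fixes q :: complex
  assumes "0 < norm q" "norm q < 1"
  shows "2 * (\<Sum>n. q ^ (n * Suc n div 2)) = theta_j (- 1) q"
proof -
  have q2: "norm (q\<^sup>2) < 1"
    using assms by (simp add: norm_power power_less_one_iff)
  define P where "P = (\<lambda>n. qpoch (q\<^sup>2) (q\<^sup>2) n / qpoch q (q\<^sup>2) n)"
  define P' where "P' = qpoch_inf (q\<^sup>2) (q\<^sup>2) / qpoch_inf q (q\<^sup>2)"
  have nz: "qpoch_inf q (q\<^sup>2) \<noteq> 0" "qpoch_inf (q\<^sup>2) (q\<^sup>2) \<noteq> 0"
    by (rule qpoch_inf_nonzero'; use q2 assms in simp)+
  have q1: "q ^ Suc n \<noteq> 1" for n
    using norm_power_neq_1[OF assms(2), of "Suc n"] by simp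
  have P_lim: "P \<longlonglongrightarrow> P'"
    unfolding P_def P'_def by (intro tendsto_intros qpoch_LIMSEQ q2 nz)
  have "(\<lambda>n. inverse (P n)) \<longlonglongrightarrow> inverse P'"
    by (intro tendsto_intros P_lim) (use nz in \<open>simp add: P'_def\<close>)
  hence "Bseq (\<lambda>n. inverse (P n))"
    by (intro convergent_imp_Bseq) (auto simp: convergent_def)
  then obtain K where K: "K > 0" "\<And>n. norm (inverse (P n)) \<le> K"
    unfolding Bseq_def by blast
  have P0: "P 0 = 1" by (simp add: P_def)
  have shanks: "(\<Sum>k<2*n. q ^ (k * Suc k div 2)) = P n * (\<Sum>s<n. q ^ (s * (2 * n + 1)) / P s)" for n
  proof (rule shanks_identity)
    show "P (Suc n) = P n * (1 - q ^ (2 * n + 2)) / (1 - q ^ (2 * n + 1))" for n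
    proof -
      have "q\<^sup>2 * q\<^sup>2 ^ n = q ^ (2 * n + 2)" "q * q\<^sup>2 ^ n = q ^ (2 * n + 1)" for n
        by (simp_all add: power_mult power2_eq_square)
      thus ?thesis by (simp add: P_def qpoch_Suc)
    qed
  qed (use q1 P0 in auto)
  define U where "U = (\<lambda>n. (\<Sum>s<n. q ^ (s * (2 * n + 1)) / P s))"
  \<comment> \<open>The index \<open>Suc n\<close> allows the term s = 0, which equals 1, to be
    split off; each of the \<open>n\<close> remaining terms is at most K |q|^n in norm.\<close>
  have "(\<lambda>n. U (Suc n) - 1) \<longlonglongrightarrow> 0"
  proof (rule Lim_null_comparison)
    show "\<forall>\<^sub>F n in sequentially. norm (U (Suc n) - 1) \<le> K * norm (of_nat n * q ^ n)"
    proof (intro always_eventually allI)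
      fix n
      have "U (Suc n) - 1 = (\<Sum>s<n. q ^ (Suc s * (2 * Suc n + 1)) / P (Suc s))"
        unfolding U_def sum.lessThan_Suc_shift
        by (simp only: P0 mult_zero_left power_0 div_by_1 add_diff_cancel_left')
      also have "norm \<dots> \<le> of_nat (card {..<n}) * (K * norm q ^ n)"
      proof (rule sum_norm_bound)
        fix s assume "s \<in> {..<n}"
        have "n \<le> Suc s * (2 * Suc n + 1)" by simp
        hence "norm q ^ (Suc s * (2 * Suc n + 1)) \<le> norm q ^ n"
          using assms by (intro power_decreasing) auto
        hence "norm (inverse (P (Suc s))) * norm q ^ (Suc s * (2 * Suc n + 1)) \<le> K * norm q ^ n"
          using K by (intro mult_mono) auto
        thus "norm (q ^ (Suc s * (2 * Suc n + 1)) / P (Suc s)) \<le> K * norm q ^ n"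
          by (simp only: divide_inverse norm_mult norm_power mult.commute)
      qed
      also have "\<dots> = K * norm (of_nat n * q ^ n)"
        by (simp add: norm_mult norm_power)
      finally show "norm (U (Suc n) - 1) \<le> K * norm (of_nat n * q ^ n)" .
    qed
    have "(\<lambda>n. of_nat n * q ^ n) \<longlonglongrightarrow> 0"
      using assms by (intro powser_times_n_limit_0) auto
    thus "(\<lambda>n. K * norm (of_nat n * q ^ n)) \<longlonglongrightarrow> 0"
      by (intro tendsto_mult_right_zero tendsto_norm_zero)
  qed
  hence "U \<longlonglongrightarrow> 1"
    by (subst filterlim_sequentially_Suc[symmetric]) (simp add: LIM_zero_iff)
  hence "(\<lambda>n. P n * U n) \<longlonglongrightarrow> P' * 1"
    by (intro tendsto_intros P_lim)
  hence 1: "(\<lambda>n. \<Sum>k<2*n. q ^ (k * Suc k div 2)) \<longlonglongrightarrow> P'"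
    unfolding shanks U_def by simp
  have "summable (\<lambda>k. q ^ (k * Suc k div 2))"
    using summable_norm_power_triangular[OF assms(2)] by (rule summable_norm_cancel)
  hence "(\<lambda>n. \<Sum>k<n. q ^ (k * Suc k div 2)) \<longlonglongrightarrow> (\<Sum>k. q ^ (k * Suc k div 2))"
    by (rule summable_LIMSEQ)
  from LIMSEQ_subseq_LIMSEQ[OF this, of "\<lambda>n. 2 * n"]
  have "(\<lambda>n. \<Sum>k<2*n. q ^ (k * Suc k div 2)) \<longlonglongrightarrow> (\<Sum>k. q ^ (k * Suc k div 2))"
    by (simp add: o_def strict_mono_def)
  with 1 have S: "(\<Sum>k. q ^ (k * Suc k div 2)) = P'"
    by (rule LIMSEQ_unique[rotated])
  have e1: "qpoch_inf q q = qpoch_inf q (q\<^sup>2) * qpoch_inf (q\<^sup>2) (q\<^sup>2)"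
    using qpoch_inf_bisect[OF assms(2), of q] by (simp add: power2_eq_square)
  have e2: "qpoch_inf q q * qpoch_inf (- q) q = qpoch_inf (q\<^sup>2) (q\<^sup>2)"
    using qpoch_inf_mult_minus[OF assms(2)] .
  have e3: "qpoch_inf (- q) q * qpoch_inf q (q\<^sup>2) = 1"
    using e2 nz unfolding e1 by (simp add: mult.commute)
  have "theta_j (- 1) q = 2 * (qpoch_inf (- q) q * (qpoch_inf q q * qpoch_inf (- q) q))"
    unfolding theta_j_def using qpoch_inf_step[OF assms(2), of "-1"] by simp
  also have "\<dots> = 2 * P'"
    unfolding e2 P'_def using e3 nz(1) by (simp add: field_simps)
  finally show ?thesis
    unfolding S by simp
qed

subsection \<open>Appell--Lerch sums\<close>

lemma bij_int_shift: "bij (\<lambda>r::int. r - 1)"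
  by (rule bij_betwI[of _ _ _ "\<lambda>r. r + 1"]) auto

text \<open>The numerator series of m(a,q,-1): at z = -1 the signs (-1)^r and z^r cancel. The index
  set is a parameter so that the one term with a pole at a given point can be left out.\<close>

definition appell_sum :: "int set \<Rightarrow> complex \<Rightarrow> complex \<Rightarrow> complex" where
  "appell_sum I q a = (\<Sum>\<^sub>\<infinity>r\<in>I. q powi (r * (r - 1) div 2) / (1 + q powi (r - 1) * a))"

lemma appell_lerch_m_minus_1:
  "appell_lerch_m a q (-1) = appell_sum UNIV q a / theta_j (-1) q"
proof -
  have "(-1) powi r * q powi (r * (r - 1) div 2) * (-1) powi r / (1 - q powi (r - 1) * a * (-1))
      = q powi (r * (r - 1) div 2) / (1 + q powi (r - 1) * a)" for r :: int
  proof -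
    have "(-1 :: complex) powi r * (-1) powi r = 1"
      by (simp flip: power_int_mult_distrib)
    thus ?thesis by (simp add: mult_ac)
  qed
  thus ?thesis
    unfolding appell_lerch_m_def appell_sum_def by (simp only:) simp
qed

text \<open>The powers of q accumulate only at 0 and infinity: for |k| > N either |q^k| < |a|/2 or
  |q^k| > 2|a|, and a minimum over finitely many k remains. Indices with a = -q^k are excluded
  rather than forbidden, since the lemma is also used at poles. The factor 2 leaves a distance of at
  least \<open>\<eta>\<close> on the whole closed ball of radius \<open>\<eta>\<close> about
  \<open>a\<close>.\<close>

lemma int_powers_discrete:
  fixes q a :: complex
  assumes q: "0 < norm q" "norm q < 1" and a: "a \<noteq> 0"
  obtains \<eta> where "\<eta> > 0" "\<And>k. a \<noteq> - (q powi k) \<Longrightarrow> 2 * \<eta> \<le> norm (a + q powi k)"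
proof -
  have "min (norm a / 2) (1 / (2 * norm a)) > 0"
    using a by simp
  then obtain N where N: "norm q ^ N < min (norm a / 2) (1 / (2 * norm a))"
    using real_arch_pow_inv q(2) by blast
  define F where "F = {k \<in> {- int N..int N}. a \<noteq> - (q powi k)}"
  define \<mu> where "\<mu> = Min (insert (norm a / 2) ((\<lambda>k. norm (a + q powi k)) ` F))"
  have fin: "finite (insert (norm a / 2) ((\<lambda>k. norm (a + q powi k)) ` F))"
    unfolding F_def by (intro finite.insertI finite_imageI finite_Collect_conjI) auto
  have pos: "\<mu> > 0"
    unfolding \<mu>_def using fin a by (subst Min_gr_iff) (auto simp: F_def add_eq_0_iff2)
  have bound: "\<mu> \<le> norm (a + q powi k)" if k: "a \<noteq> - (q powi k)" for k
  proof (cases "k \<in> {- int N..int N}")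
    case True
    thus ?thesis
      unfolding \<mu>_def using fin k by (intro Min_le) (auto simp: F_def)
  next
    case False
    have "norm a / 2 \<le> norm (a + q powi k)"
    proof (cases "k > int N")
      case True
      have "norm (q powi k) = norm q ^ nat k"
        using True by (simp add: norm_power power_int_def)
      also have "\<dots> \<le> norm q ^ N"
        using q True by (intro power_decreasing) auto
      finally have "norm (q powi k) < norm a / 2"
        using N by simp
      thus ?thesis
        using norm_diff_ineq[of a "q powi k"] by simp
    next
      case 2: False
      have "norm q ^ nat (- k) \<le> norm q ^ N"
        using q False 2 by (intro power_decreasing) auto
      hence less: "norm q ^ nat (- k) < 1 / (2 * norm a)"
        using N by simp
      have "norm (q powi k) = 1 / norm q ^ nat (- k)"
        using False 2 by (simp add: power_int_def divide_inverse norm_inverse norm_power power_inverse)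
      moreover have "2 * norm a < 1 / norm q ^ nat (- k)"
        using less q(1) a zero_less_power[OF q(1), of "nat (- k)"] by (simp add: field_simps)
      ultimately have "norm (q powi k) > 2 * norm a"
        by (simp only:)
      moreover have "norm (q powi k) - norm a \<le> norm (a + q powi k)"
        using norm_diff_ineq[of "q powi k" a] by (simp add: add.commute)
      ultimately show ?thesis
        using norm_ge_zero[of a] by linarith
    qed
    moreover have "\<mu> \<le> norm a / 2"
      unfolding \<mu>_def using fin by (intro Min_le) auto
    ultimately show ?thesis by linarith
  qed
  show ?thesis
    by (rule that[of "\<mu> / 2"]) (use pos bound in auto)
qed

text \<open>Displays the pole of the term with index \<open>r\<close>, at -q^(1-r), and the distance
  from it as the quantity to be bounded below.\<close>

lemma appell_denominator:
  fixes q a :: complex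
  assumes "q \<noteq> 0"
  shows "1 + q powi (r - 1) * a = q powi (r - 1) * (a + q powi (1 - r))"
proof -
  have "q powi (r - 1) * q powi (1 - r) = 1"
    using assms by (simp flip: power_int_add)
  thus ?thesis by (simp add: algebra_simps)
qed

text \<open>Taking q^(r-1) out of the denominator lowers the exponent from the binomial of r to that
  of r - 1. The result is still a summable Gaussian, with no distinction between r tending to plus
  and to minus infinity.\<close>

lemma norm_appell_term_le:
  fixes q a :: complex
  assumes "q \<noteq> 0" "\<eta> > 0" "\<eta> \<le> norm (a + q powi (1 - r))"
  shows "norm (q powi (r * (r - 1) div 2) / (1 + q powi (r - 1) * a))
           \<le> norm q powi ((r - 1) * (r - 1 - 1) div 2) / \<eta>"
proof -
  have "q powi (r * (r - 1) div 2) = q powi ((r - 1) * (r - 1 - 1) div 2) * q powi (r - 1)"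
    using assms(1) by (subst choose_two_int_diff_1) (simp only: power_int_add simp_thms)
  hence "q powi (r * (r - 1) div 2) / (1 + q powi (r - 1) * a)
       = q powi ((r - 1) * (r - 1 - 1) div 2) / (a + q powi (1 - r))"
    unfolding appell_denominator[OF assms(1)] using assms(1) by simp
  hence "norm (q powi (r * (r - 1) div 2) / (1 + q powi (r - 1) * a))
       = norm q powi ((r - 1) * (r - 1 - 1) div 2) / norm (a + q powi (1 - r))"
    by (simp only: norm_divide norm_power_int)
  also have "\<dots> \<le> norm q powi ((r - 1) * (r - 1 - 1) div 2) / \<eta>"
    using assms by (intro divide_left_mono mult_pos_pos) auto
  finally show ?thesis .
qed

lemma summable_appell_majorant:
  fixes q :: complex
  assumes "norm q < 1"
  shows "(\<lambda>r::int. norm q powi ((r - 1) * (r - 1 - 1) div 2) / \<eta>) summable_on I"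
proof -
  have "(\<lambda>r::int. norm q powi (r * (r - 1) div 2)) summable_on UNIV"
    using has_sum_power_choose_two_int[of "norm q"] assms by (auto intro: has_sum_imp_summable)
  hence "(\<lambda>r::int. norm q powi ((r - 1) * (r - 1 - 1) div 2)) summable_on UNIV"
    by (subst summable_on_reindex_bij_betw[OF bij_int_shift])
  hence "(\<lambda>r::int. norm q powi ((r - 1) * (r - 1 - 1) div 2) / \<eta>) summable_on UNIV"
    unfolding divide_inverse by (rule summable_on_cmult_left)
  thus ?thesis
    by (rule summable_on_subset_banach) simp
qed

lemma summable_appell:
  fixes q a :: complex
  assumes q: "0 < norm q" "norm q < 1" and a: "a \<noteq> 0"
    and I: "\<And>r. r \<in> I \<Longrightarrow> a \<noteq> - (q powi (1 - r))"
  shows "(\<lambda>r. q powi (r * (r - 1) div 2) / (1 + q powi (r - 1) * a)) summable_on I"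
proof -
  obtain \<eta> where \<eta>: "\<eta> > 0" "\<And>k. a \<noteq> - (q powi k) \<Longrightarrow> 2 * \<eta> \<le> norm (a + q powi k)"
    using int_powers_discrete[OF q a] by blast
  show ?thesis
  proof (rule abs_summable_summable, rule Infinite_Sum.abs_summable_on_comparison_test')
    show "(\<lambda>r. norm q powi ((r - 1) * (r - 1 - 1) div 2) / (2 * \<eta>)) summable_on I"
      by (rule summable_appell_majorant[OF q(2)])
    show "norm (q powi (r * (r - 1) div 2) / (1 + q powi (r - 1) * a))
            \<le> norm q powi ((r - 1) * (r - 1 - 1) div 2) / (2 * \<eta>)" if "r \<in> I" for r
      using q \<eta> I[OF that] by (intro norm_appell_term_le) auto
  qed
qed

text \<open>Applies at a pole of the full sum too, once the offending index is left out of
  \<open>I\<close>; this supplies the regular parts in the residue computations.\<close>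

lemma appell_sum_analytic:
  assumes q: "0 < norm q" "norm q < 1" and a: "a \<noteq> 0"
    and I: "\<And>r. r \<in> I \<Longrightarrow> a \<noteq> - (q powi (1 - r))"
  shows "appell_sum I q analytic_on {a}"
proof -
  have q0: "q \<noteq> 0" using q by auto
  obtain \<eta> where \<eta>: "\<eta> > 0" "\<And>k. a \<noteq> - (q powi k) \<Longrightarrow> 2 * \<eta> \<le> norm (a + q powi k)"
    using int_powers_discrete[OF q a] by blast
  have away: "\<eta> \<le> norm (x + q powi (1 - r))" if "x \<in> cball a \<eta>" "r \<in> I" for x r
  proof -
    have "norm (a + q powi (1 - r)) \<le> norm (x + q powi (1 - r)) + norm (a - x)"
      using norm_triangle_ineq[of "x + q powi (1 - r)" "a - x"] by (simp add: algebra_simps)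
    moreover have "norm (a - x) \<le> \<eta>"
      using that by (simp add: dist_norm)
    ultimately show ?thesis
      using \<eta>(2)[OF I[OF that(2)]] by linarith
  qed
  have hol: "(\<lambda>x. \<Sum>r\<in>X. q powi (r * (r - 1) div 2) / (1 + q powi (r - 1) * x)) holomorphic_on cball a \<eta>"
    if "X \<subseteq> I" for X
  proof (intro holomorphic_intros)
    fix r x assume "r \<in> X" "x \<in> cball a \<eta>"
    hence "\<eta> \<le> norm (x + q powi (1 - r))"
      using that away by auto
    hence "x + q powi (1 - r) \<noteq> 0"
      using \<eta> by auto
    thus "1 + q powi (r - 1) * x \<noteq> 0"
      unfolding appell_denominator[OF q0] using q0 by simp
  qed
  have "\<forall>\<^sub>F X in finite_subsets_at_top I.
          continuous_on (cball a \<eta>) (\<lambda>x. \<Sum>r\<in>X. q powi (r * (r - 1) div 2) / (1 + q powi (r - 1) * x)) \<and>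
          (\<lambda>x. \<Sum>r\<in>X. q powi (r * (r - 1) div 2) / (1 + q powi (r - 1) * x)) holomorphic_on ball a \<eta>"
    using holomorphic_on_imp_continuous_on[OF hol] holomorphic_on_subset[OF hol ball_subset_cball]
    by (intro eventually_finite_subsets_at_top_weakI) auto
  moreover have "uniform_limit (cball a \<eta>)
      (\<lambda>X x. \<Sum>r\<in>X. q powi (r * (r - 1) div 2) / (1 + q powi (r - 1) * x))
      (appell_sum I q) (finite_subsets_at_top I)"
    unfolding appell_sum_def
  proof (rule Weierstrass_m_test_general)
    show "(\<lambda>r. norm q powi ((r - 1) * (r - 1 - 1) div 2) / \<eta>) summable_on I"
      by (rule summable_appell_majorant[OF q(2)])
    show "norm (q powi (r * (r - 1) div 2) / (1 + q powi (r - 1) * x))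
            \<le> norm q powi ((r - 1) * (r - 1 - 1) div 2) / \<eta>" if "r \<in> I" "x \<in> cball a \<eta>" for r x
      by (rule norm_appell_term_le[OF q0 \<eta>(1) away[OF that(2,1)]])
  qed
  ultimately have "appell_sum I q holomorphic_on ball a \<eta>"
    by (rule holomorphic_uniform_limit) simp_all
  thus ?thesis
    using \<eta>(1) by (auto simp: analytic_at intro!: exI[of _ "ball a \<eta>"])
qed

lemma appell_sum_split:
  assumes q: "0 < norm q" "norm q < 1" and a: "a \<noteq> 0"
    and generic: "\<And>k::int. a \<noteq> - (q powi k)"
  shows "appell_sum UNIV q a
           = q powi (r * (r - 1) div 2) / (1 + q powi (r - 1) * a) + appell_sum (- {r}) q a"
proof -
  have "UNIV = insert r (- {r})" by auto
  thus ?thesis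
    unfolding appell_sum_def using infsum_insert[of _ "- {r}" r] summable_appell[OF q a generic, of "- {r}"]
    by (metis (no_types, lifting) ComplD singletonI)
qed

text \<open>After r -> r - 1 both sums have the denominator 1 + x with x = q^(r-1) a. Then 1/(1 + x)
  = 1 - x/(1 + x) splits each term into a pure Gaussian and -a times the original term; the
  Gaussians sum to the theta constant.\<close>

lemma appell_sum_shift:
  assumes q: "0 < norm q" "norm q < 1" and a: "a \<noteq> 0"
    and generic: "\<And>k::int. a \<noteq> - (q powi k)"
  shows "appell_sum UNIV q (q * a) = theta_j (-1) q - a * appell_sum UNIV q a"
proof -
  have q0: "q \<noteq> 0" using q by auto
  let ?t = "\<lambda>r::int. q powi ((r - 1) * (r - 1 - 1) div 2)"
  have term_eq: "?t r / (1 + q powi (r - 1 - 1) * (q * a))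
      = ?t r - a * (q powi (r * (r - 1) div 2) / (1 + q powi (r - 1) * a))" for r
  proof -
    have 1: "q powi (r * (r - 1) div 2) = ?t r * q powi (r - 1)"
      using q0 by (subst choose_two_int_diff_1) (simp only: power_int_add simp_thms)
    have 2: "q powi (r - 1) = q powi (r - 1 - 1) * q"
      using q0 power_int_add_1[of q "r - 1 - 1"] by simp
    have "a + q powi (1 - r) \<noteq> 0"
      using generic[of "1 - r"] by (simp add: add_eq_0_iff2)
    hence 3: "1 + q powi (r - 1) * a \<noteq> 0"
      unfolding appell_denominator[OF q0] using q0 by simp
    have "1 + q powi (r - 1 - 1) * (q * a) = 1 + q powi (r - 1) * a"
      unfolding 2 by (simp add: mult_ac)
    thus ?thesis
      unfolding 1 using 3 by (simp add: field_simps)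
  qed
  have "((\<lambda>r::int. q powi (r * (r - 1) div 2)) has_sum theta_j (-1) q) UNIV"
    using has_sum_power_choose_two_int[OF q(2)] unfolding gauss_triangular[OF q] .
  hence 1: "(?t has_sum theta_j (-1) q) UNIV"
    by (subst has_sum_reindex_bij_betw[OF bij_int_shift])
  have 2: "((\<lambda>r. a * (q powi (r * (r - 1) div 2) / (1 + q powi (r - 1) * a))) has_sum
        (a * appell_sum UNIV q a)) UNIV"
    unfolding appell_sum_def using summable_appell[OF q a generic] by (intro has_sum_cmult_right has_sum_infsum)
  have "appell_sum UNIV q (q * a) = (\<Sum>\<^sub>\<infinity>r. ?t r / (1 + q powi (r - 1 - 1) * (q * a)))"
    unfolding appell_sum_def by (subst infsum_reindex_bij_betw[OF bij_int_shift]) (rule refl)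
  also have "\<dots> = theta_j (-1) q - a * appell_sum UNIV q a"
    unfolding term_eq using has_sum_add[OF 1 has_sum_uminusI[OF 2]] by (simp add: infsumI)
  finally show ?thesis .
qed

lemma theta_j_minus_1_nonzero:
  assumes "0 < norm q" "norm q < 1"
  shows "theta_j (-1) q \<noteq> 0"
proof -
  have "qpoch_inf (- q) q \<noteq> 0" "qpoch_inf q q \<noteq> 0"
    by (rule qpoch_inf_nonzero'; use assms in simp)+
  thus ?thesis
    unfolding theta_j_def using qpoch_inf_step[OF assms(2), of "-1"] by simp
qed

lemma appell_lerch_shift:
  assumes "0 < norm q" "norm q < 1" "a \<noteq> 0" "\<And>k::int. a \<noteq> - (q powi k)"
  shows "appell_lerch_m (q * a) q (-1) = 1 - a * appell_lerch_m a q (-1)"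
  unfolding appell_lerch_m_minus_1 appell_sum_shift[OF assms]
  using theta_j_minus_1_nonzero[OF assms(1,2)] by (simp add: diff_divide_distrib)

subsection \<open>The Eulerian series\<close>

definition mock_term :: "complex \<Rightarrow> complex \<Rightarrow> nat \<Rightarrow> complex" where
  "mock_term q a n = qpoch (a * q) (q\<^sup>2) n * qpoch (q / a) (q\<^sup>2) n * q ^ (2 * n + 1)
                       / qpoch (- q) q (2 * n + 1)"

definition mock_sum :: "complex \<Rightarrow> complex \<Rightarrow> complex" where
  "mock_sum q a = (1 + 1 / a) * (\<Sum>n. mock_term q a n)"

lemma one_plus_power_nonzero:
  fixes q :: complex
  assumes "norm q < 1" "n > 0"
  shows "1 + q ^ n \<noteq> 0"
proof
  assume "1 + q ^ n = 0"
  hence "norm (q ^ n) = 1"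
    by (metis add_eq_0_iff norm_minus_cancel norm_one)
  moreover have "norm q ^ n < 1"
    using assms by (simp add: power_less_one_iff)
  ultimately show False
    by (simp add: norm_power)
qed

lemma qpoch_minus_nonzero:
  fixes q :: complex
  assumes "norm q < 1"
  shows "qpoch (- q) q n \<noteq> 0"
  unfolding qpoch_def using one_plus_power_nonzero[OF assms, of "Suc _"] by simp

text \<open>Here \<open>K\<close> bounds the reciprocals of (-q;q)_n, which converge because
  (-q;q)_inf is nonzero. It is chosen before \<open>a\<close>, which enters only through a common
  bound \<open>R\<close> of |a| and |1/a|, so one estimate gives pointwise convergence as well as
  uniform convergence on compact sets away from 0.\<close>

lemma mock_term_majorant:
  assumes "norm q < 1"
  shows "\<exists>K. \<forall>a n R. norm a \<le> R \<longrightarrow> norm (1 / a) \<le> R \<longrightarrow>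
           norm (mock_term q a n) \<le> K * exp (R / (1 - norm q ^ 2)) ^ 2 * norm q ^ n"
proof -
  have q2: "norm (q\<^sup>2) < 1"
    using assms by (simp add: norm_power power_less_one_iff)
  have nz: "qpoch_inf (- q) q \<noteq> 0"
    by (rule qpoch_inf_nonzero') (use assms in auto)
  have "(\<lambda>n. inverse (qpoch (- q) q n)) \<longlonglongrightarrow> inverse (qpoch_inf (- q) q)"
    by (intro tendsto_intros qpoch_LIMSEQ assms nz)
  hence "Bseq (\<lambda>n. inverse (qpoch (- q) q n))"
    by (intro convergent_imp_Bseq) (auto simp: convergent_def)
  then obtain K where K: "K > 0" "\<And>n. norm (inverse (qpoch (- q) q n)) \<le> K"
    unfolding Bseq_def by blast
  show ?thesis
  proof (intro exI[of _ K] allI impI)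
    fix a :: complex and n :: nat and R :: real
    assume R: "norm a \<le> R" "norm (1 / a) \<le> R"
    define E where "E = exp (R / (1 - norm q ^ 2))"
    have E: "norm (qpoch x (q\<^sup>2) n) \<le> E" if "norm x \<le> R" for x
    proof -
      have "norm (qpoch x (q\<^sup>2) n) \<le> exp (norm x / (1 - norm (q\<^sup>2)))"
        by (rule norm_qpoch_le[OF q2])
      also have "\<dots> \<le> E"
        unfolding E_def using that q2 by (auto simp: norm_power intro!: divide_right_mono)
      finally show ?thesis .
    qed
    have "norm (a * q) \<le> R"
      using R(1) mult_right_le_one_le[of "norm a" "norm q"] assms by (simp add: norm_mult)
    moreover have "norm (q / a) \<le> R"
      using R(2) mult_right_le_one_le[of "norm (1 / a)" "norm q"] assms by (simp add: norm_divide)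
    moreover have "norm q ^ (2 * n + 1) \<le> norm q ^ n"
      using assms by (intro power_decreasing) auto
    ultimately have "norm (qpoch (a * q) (q\<^sup>2) n) * norm (qpoch (q / a) (q\<^sup>2) n) * norm q ^ (2 * n + 1)
            * norm (inverse (qpoch (- q) q (2 * n + 1))) \<le> E * E * norm q ^ n * K"
      by (intro mult_mono E K) (auto simp: E_def)
    thus "norm (mock_term q a n) \<le> K * exp (R / (1 - norm q ^ 2)) ^ 2 * norm q ^ n"
      unfolding mock_term_def E_def[symmetric]
      by (simp only: divide_inverse norm_mult norm_power power2_eq_square mult_ac)
  qed
qed

lemma summable_mock_term:
  assumes "norm q < 1"
  shows "summable (mock_term q a)"
proof -
  obtain K where K: "\<And>a n R. norm a \<le> R \<Longrightarrow> norm (1 / a) \<le> R \<Longrightarrow>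
       norm (mock_term q a n) \<le> K * exp (R / (1 - norm q ^ 2)) ^ 2 * norm q ^ n"
    using mock_term_majorant[OF assms] by blast
  show ?thesis
  proof (rule summable_comparison_test')
    show "summable (\<lambda>n. K * exp (max (norm a) (norm (1 / a)) / (1 - norm q ^ 2)) ^ 2 * norm q ^ n)"
      using assms by (intro summable_mult summable_geometric) auto
  qed (rule K; simp)
qed

lemma mock_sum_analytic:
  assumes q: "norm q < 1" and a: "a \<noteq> 0"
  shows "mock_sum q analytic_on {a}"
proof -
  obtain K where K: "\<And>a n R. norm a \<le> R \<Longrightarrow> norm (1 / a) \<le> R \<Longrightarrow>
       norm (mock_term q a n) \<le> K * exp (R / (1 - norm q ^ 2)) ^ 2 * norm q ^ n"
    using mock_term_majorant[OF q] by blast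
  define r where "r = norm a / 2"
  \<comment> \<open>The radius |a|/2 keeps the closed ball at distance \<open>r\<close> from 0, so
    \<open>R\<close> bounds both |x| and |1/x| on it.\<close>
  define R where "R = max (norm a + r) (1 / r)"
  have r: "r > 0" using a by (simp add: r_def)
  have lower: "r \<le> norm x" if "x \<in> cball a r" for x
    using that norm_triangle_ineq2[of a "a - x"] by (simp add: dist_norm r_def)
  have nz: "x \<noteq> 0" if "x \<in> cball a r" for x
    using lower[OF that] r by auto
  have upper: "norm x \<le> norm a + r" if "x \<in> cball a r" for x
    using that norm_triangle_ineq2[of x a] by (simp add: dist_norm norm_minus_commute)
  have "(\<lambda>x. \<Sum>n. mock_term q x n) holomorphic_on ball a r"
  proof (rule holomorphic_uniform_sequence_cball)
    show "(\<lambda>x. \<Sum>n<N. mock_term q x n) holomorphic_on cball a r" for N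
      unfolding mock_term_def qpoch_def
      by (intro holomorphic_intros)
         (use nz qpoch_minus_nonzero[OF q] in \<open>auto simp: qpoch_def\<close>)
    show "uniform_limit (cball a r) (\<lambda>N x. \<Sum>n<N. mock_term q x n) (\<lambda>x. \<Sum>n. mock_term q x n) sequentially"
    proof (rule Weierstrass_m_test)
      fix n x assume x: "x \<in> cball a r"
      show "norm (mock_term q x n) \<le> K * exp (R / (1 - norm q ^ 2)) ^ 2 * norm q ^ n"
      proof (rule K)
        show "norm x \<le> R" using upper[OF x] by (simp add: R_def)
        have "norm (1 / x) \<le> 1 / r"
          using lower[OF x] r by (auto simp: norm_divide intro!: divide_left_mono mult_pos_pos)
        thus "norm (1 / x) \<le> R" by (simp add: R_def)
      qed
    next
      show "summable (\<lambda>n. K * exp (R / (1 - norm q ^ 2)) ^ 2 * norm q ^ n)"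
        using q by (intro summable_mult summable_geometric) auto
    qed
  qed
  hence "mock_sum q holomorphic_on ball a r"
    unfolding mock_sum_def using nz by (intro holomorphic_intros) auto
  thus ?thesis
    using r by (auto simp: analytic_at intro!: exI[of _ "ball a r"])
qed

text \<open>A finite form of \<open>theta_j_shift\<close>: the first product loses its factor 1 -
  aq, the second gains 1 - 1/(aq). Hence the lengths drift apart, to n + 2 and n.\<close>

lemma qpoch_shift_pair:
  fixes a q :: complex
  assumes "q \<noteq> 0" "a \<noteq> 0"
  shows "a * q * (qpoch (q\<^sup>2 * a * q) (q\<^sup>2) (Suc n) * qpoch (q / (q\<^sup>2 * a)) (q\<^sup>2) (Suc n))
       = - (qpoch (a * q) (q\<^sup>2) (Suc (Suc n)) * qpoch (q / a) (q\<^sup>2) n)"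
proof -
  have 1: "qpoch (q / (q\<^sup>2 * a)) (q\<^sup>2) (Suc n) = (1 - 1 / (a * q)) * qpoch (q / a) (q\<^sup>2) n"
    using assms by (subst qpoch_Suc_left) (simp add: power2_eq_square field_simps)
  have 2: "qpoch (a * q) (q\<^sup>2) (Suc (Suc n)) = (1 - a * q) * qpoch (q\<^sup>2 * a * q) (q\<^sup>2) (Suc n)"
    by (subst qpoch_Suc_left) (simp add: mult_ac)
  have 3: "a * q * (1 - 1 / (a * q)) = - (1 - a * q)"
    using assms by (simp add: field_simps)
  have "a * q * (qpoch (q\<^sup>2 * a * q) (q\<^sup>2) (Suc n) * qpoch (q / (q\<^sup>2 * a)) (q\<^sup>2) (Suc n))
      = (a * q * (1 - 1 / (a * q))) * qpoch (q\<^sup>2 * a * q) (q\<^sup>2) (Suc n) * qpoch (q / a) (q\<^sup>2) n"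
    unfolding 1 by (simp only: mult_ac)
  also have "\<dots> = - (1 - a * q) * qpoch (q\<^sup>2 * a * q) (q\<^sup>2) (Suc n) * qpoch (q / a) (q\<^sup>2) n"
    by (simp only: 3)
  finally show ?thesis
    unfolding 2 by (simp only: mult_minus_left)
qed

text \<open>The weights are the prefactor of \<open>mock_sum\<close> at q^2 a and a (1 + 1/a) = 1 +
  a. In terms of (aq;q^2) and (q/a;q^2), the two summands with index N + 1 have lengths (N + 2, N),
  by \<open>qpoch_shift_pair\<close>, and (N + 1, N + 1); the closed form is built on their common
  part of lengths (N + 1, N). Its limit is not 0 in general but produces the theta quotient of the
  shift equation.\<close>

lemma mock_term_telescope:
  fixes a q :: complex
  assumes q: "norm q < 1" "q \<noteq> 0" and a: "a \<noteq> 0"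
  shows "(\<Sum>n<Suc N. (1 + 1 / (q\<^sup>2 * a)) * mock_term q (q\<^sup>2 * a) n + (1 + a) * mock_term q a n)
       = 2 + (1 / (a * q) - 1) * qpoch (a * q) (q\<^sup>2) (Suc N) * qpoch (q / a) (q\<^sup>2) N
               / qpoch (- q) q (2 * N + 1)"
proof (induction N)
  case 0
  have nz: "1 + q \<noteq> 0"
    using one_plus_power_nonzero[OF q(1), of 1] by simp
  have t0: "mock_term q b 0 = q / (1 + q)" for b
    by (simp add: mock_term_def qpoch_Suc)
  have "(1 + 1 / (q\<^sup>2 * a)) * (q / (1 + q)) + (1 + a) * (q / (1 + q))
      = ((1 + 1 / (q\<^sup>2 * a)) * q + (1 + a) * q) / (1 + q)"
    by (simp only: add_divide_distrib times_divide_eq_right)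
  also have "(1 + 1 / (q\<^sup>2 * a)) * q + (1 + a) * q = 2 * (1 + q) + (1 / (a * q) - 1) * (1 - a * q)"
    using q a by (simp add: field_simps power2_eq_square)
  also have "\<dots> / (1 + q) = 2 + (1 / (a * q) - 1) * (1 - a * q) / (1 + q)"
    unfolding add_divide_distrib[of "2 * (1 + q)"] using nz by (simp del: distrib_left_numeral)
  finally show ?case
    by (simp add: t0 qpoch_Suc)
next
  case (Suc N)
  define y where "y = q ^ (2 * N + 2)"
  define p where "p = qpoch (a * q) (q\<^sup>2) (Suc N) * qpoch (q / a) (q\<^sup>2) N"
  define d where "d = qpoch (- q) q (2 * N + 1)"
  have y: "1 + y \<noteq> 0" "1 + q * y \<noteq> 0"
    using one_plus_power_nonzero[OF q(1), of "2 * N + 2"]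
          one_plus_power_nonzero[OF q(1), of "2 * N + 3"]
    by (simp_all add: y_def numeral_3_eq_3)
  have d: "d \<noteq> 0" unfolding d_def by (rule qpoch_minus_nonzero[OF q(1)])
  have y': "q\<^sup>2 ^ Suc N = y" by (simp add: y_def power_mult power2_eq_square)
  have P1: "qpoch (a * q) (q\<^sup>2) (Suc (Suc N)) * qpoch (q / a) (q\<^sup>2) N = p * (1 - a * q * y)"
    unfolding p_def qpoch_Suc[of _ _ "Suc N"] y' by simp
  have y'': "q / a * q\<^sup>2 ^ N = y / (a * q)"
    using q by (simp add: y_def power_mult power2_eq_square)
  have P2: "qpoch (a * q) (q\<^sup>2) (Suc N) * qpoch (q / a) (q\<^sup>2) (Suc N) = p * (1 - y / (a * q))"
    unfolding p_def qpoch_Suc[of "q / a" _ N] y'' by simp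
  have P3: "qpoch (a * q) (q\<^sup>2) (Suc (Suc N)) * qpoch (q / a) (q\<^sup>2) (Suc N)
          = p * (1 - a * q * y) * (1 - y / (a * q))"
    unfolding p_def qpoch_Suc[of "q / a" _ N] qpoch_Suc[of _ _ "Suc N"] y' y'' by simp
  have D: "qpoch (- q) q (2 * Suc N + 1) = d * (1 + y) * (1 + q * y)"
    unfolding d_def y_def by (simp add: qpoch_Suc mult_ac)
  have e: "q ^ (2 * Suc N + 1) = q * y"
    by (simp add: y_def)
  have T1: "mock_term q (q\<^sup>2 * a) (Suc N)
          = - (p * (1 - a * q * y)) / (a * q) * (q * y) / (d * (1 + y) * (1 + q * y))"
  proof -
    have "qpoch (q\<^sup>2 * a * q) (q\<^sup>2) (Suc N) * qpoch (q / (q\<^sup>2 * a)) (q\<^sup>2) (Suc N)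
        = - (p * (1 - a * q * y)) / (a * q)"
      using qpoch_shift_pair[OF q(2) a, of N] unfolding P1 using q a by (simp add: field_simps)
    thus ?thesis unfolding mock_term_def D e by simp
  qed
  have T2: "mock_term q a (Suc N) = p * (1 - y / (a * q)) * (q * y) / (d * (1 + y) * (1 + q * y))"
    unfolding mock_term_def D e P2 by simp
  \<comment> \<open>With \<open>p\<close> and the denominators taken out, the induction step is this
    rational identity in \<open>a\<close>, \<open>q\<close> and y = q^(2N+2).\<close>
  have key: "(1 + 1 / (q\<^sup>2 * a)) * (- (1 - a * q * y) / (a * q) * (q * y)) + (1 + a) * ((1 - y / (a * q)) * (q * y))
      = (1 / (a * q) - 1) * ((1 - a * q * y) * (1 - y / (a * q)) - (1 + y) * (1 + q * y))"
    using q a by (simp add: field_simps power2_eq_square)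
  \<comment> \<open>The rearrangements are stated for letters, so that \<open>field_simps\<close>
    does not expand the actual terms.\<close>
  have gen1: "A * (- (p * u) / w * z / D) + B * (p * v * z / D) = p / D * (A * (- u / w * z) + B * (v * z))"
    for A B D u v w z :: complex
    by (cases "w = 0 \<or> D = 0") (auto simp: field_simps)
  have gen2: "p / (d * e * f) * (x * (s * t - e * f)) = x * (p * s * t) / (d * e * f) - x * p / d"
    if "d \<noteq> 0" "e \<noteq> 0" "f \<noteq> 0" for d e f s t x :: complex
    using that by (simp add: field_simps)
  have "(1 + 1 / (q\<^sup>2 * a)) * mock_term q (q\<^sup>2 * a) (Suc N) + (1 + a) * mock_term q a (Suc N)
      = p / (d * (1 + y) * (1 + q * y)) *
        ((1 + 1 / (q\<^sup>2 * a)) * (- (1 - a * q * y) / (a * q) * (q * y)) + (1 + a) * ((1 - y / (a * q)) * (q * y)))"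
    unfolding T1 T2 by (rule gen1)
  also have "\<dots> = (1 / (a * q) - 1) * (p * (1 - a * q * y) * (1 - y / (a * q))) / (d * (1 + y) * (1 + q * y))
                    - (1 / (a * q) - 1) * p / d"
    unfolding key by (rule gen2[OF d y])
  finally have step: "(1 + 1 / (q\<^sup>2 * a)) * mock_term q (q\<^sup>2 * a) (Suc N) + (1 + a) * mock_term q a (Suc N)
     = (1 / (a * q) - 1) * (p * (1 - a * q * y) * (1 - y / (a * q))) / (d * (1 + y) * (1 + q * y))
                    - (1 / (a * q) - 1) * p / d" .
  show ?case
    unfolding sum.lessThan_Suc[of _ "Suc N"] Suc.IH step D
    by (simp only: P3 mult.assoc p_def[symmetric] d_def[symmetric]) simp
qed

lemma mock_sum_shift:
  fixes a q :: complex
  assumes q: "norm q < 1" "q \<noteq> 0" and a: "a \<noteq> 0"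
  shows "mock_sum q (q\<^sup>2 * a) + a * mock_sum q a
       = 2 + (1 / (a * q) - 1) * (qpoch_inf (a * q) (q\<^sup>2) * qpoch_inf (q / a) (q\<^sup>2) / qpoch_inf (- q) q)"
proof -
  have q2: "norm (q\<^sup>2) < 1"
    using q by (simp add: norm_power power_less_one_iff)
  let ?T = "\<lambda>n. (1 + 1 / (q\<^sup>2 * a)) * mock_term q (q\<^sup>2 * a) n + (1 + a) * mock_term q a n"
  have "?T sums ((1 + 1 / (q\<^sup>2 * a)) * suminf (mock_term q (q\<^sup>2 * a)) + (1 + a) * suminf (mock_term q a))"
    by (intro sums_add sums_mult summable_sums summable_mock_term q)
  moreover have "(1 + a) * suminf (mock_term q a) = a * mock_sum q a"
    using a by (simp add: mock_sum_def field_simps)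
  ultimately have "(\<lambda>N. \<Sum>n<N. ?T n) \<longlonglongrightarrow> mock_sum q (q\<^sup>2 * a) + a * mock_sum q a"
    by (simp add: sums_def mock_sum_def)
  hence "(\<lambda>N. \<Sum>n<Suc N. ?T n) \<longlonglongrightarrow> mock_sum q (q\<^sup>2 * a) + a * mock_sum q a"
    by (rule LIMSEQ_Suc)
  moreover have "(\<lambda>N. \<Sum>n<Suc N. ?T n) \<longlonglongrightarrow>
      2 + (1 / (a * q) - 1) * qpoch_inf (a * q) (q\<^sup>2) * qpoch_inf (q / a) (q\<^sup>2) / qpoch_inf (- q) q"
    unfolding mock_term_telescope[OF q a]
  proof (intro tendsto_intros qpoch_LIMSEQ q2 LIMSEQ_Suc)
    show "(\<lambda>N. qpoch (- q) q (2 * N + 1)) \<longlonglongrightarrow> qpoch_inf (- q) q"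
      using LIMSEQ_subseq_LIMSEQ[OF qpoch_LIMSEQ[OF q(1)], of "\<lambda>n. 2 * n + 1" "-q"]
      by (simp add: o_def strict_mono_def)
    show "qpoch_inf (- q) q \<noteq> 0"
      by (rule qpoch_inf_nonzero') (use q in auto)
  qed
  ultimately show ?thesis
    using LIMSEQ_unique by fastforce
qed

subsection \<open>Comparison of the two sides\<close>

text \<open>A bound on the annulus |q| <= |x| <= 1 spreads both ways. Inward, f(qy) = -y f(y) with
  |y| <= 1 does not enlarge |f|; outward, |f(x)| = |f(qx)|/|x| with |x| > 1 does not either. With
  the factor -1/a instead the conclusion fails, as the theta function shows.\<close>

lemma shift_equation_imp_zero:
  fixes f :: "complex \<Rightarrow> complex"
  assumes q: "0 < norm q" "norm q < 1"
    and ana: "f analytic_on - {0}"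
    and shift: "\<And>a. a \<noteq> 0 \<Longrightarrow> f (q * a) = - a * f a"
    and a: "a \<noteq> 0"
  shows "f a = 0"
proof -
  have q0: "q \<noteq> 0" using q by auto
  have hol: "f holomorphic_on - {0}"
    using ana by (rule analytic_imp_holomorphic)
  have "compact (cball 0 1 - ball (0::complex) (norm q))"
    by (intro compact_diff) auto
  moreover have "continuous_on (cball 0 1 - ball 0 (norm q)) f"
    by (rule continuous_on_subset[OF holomorphic_on_imp_continuous_on[OF hol]]) (use q in auto)
  ultimately have "bounded (f ` (cball 0 1 - ball 0 (norm q)))"
    by (intro compact_imp_bounded compact_continuous_image)
  then obtain B where B: "\<And>x. norm q \<le> norm x \<Longrightarrow> norm x \<le> 1 \<Longrightarrow> norm (f x) \<le> B"
    unfolding bounded_iff by (force simp: not_less)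
  have inner: "norm (f x) \<le> B" if "norm q ^ Suc n \<le> norm x" "norm x \<le> 1" for x n
    using that
  proof (induction n arbitrary: x)
    case 0
    thus ?case using B by simp
  next
    case (Suc n)
    show ?case
    proof (cases "norm q \<le> norm x")
      case True
      thus ?thesis using Suc.prems B by simp
    next
      case False
      define y where "y = x / q"
      have x: "x = q * y" using q0 by (simp add: y_def)
      have y1: "norm y \<le> 1"
        using False q by (simp add: y_def norm_divide)
      have yn: "norm q ^ Suc n \<le> norm y"
        using Suc.prems(1) q by (simp add: x norm_mult)
      have "0 < norm y"
        using less_le_trans[OF zero_less_power[OF q(1)] yn] .
      hence "y \<noteq> 0" by simp
      hence "norm (f x) = norm y * norm (f y)"
        unfolding x shift[OF \<open>y \<noteq> 0\<close>] by (simp add: norm_mult)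
      also have "\<dots> \<le> 1 * B"
        using Suc.IH[OF yn y1] y1 by (intro mult_mono) auto
      finally show ?thesis by simp
    qed
  qed
  have inner': "norm (f x) \<le> B" if "x \<noteq> 0" "norm x \<le> 1" for x
  proof -
    have "0 < norm x" using that by simp
    then obtain n where "norm q ^ n < norm x"
      using real_arch_pow_inv q(2) by blast
    moreover have "norm q ^ Suc n \<le> norm q ^ n"
      using q by (intro power_decreasing) auto
    ultimately show ?thesis
      using inner[of n x] that by simp
  qed
  have outer: "norm (f x) \<le> B" if "norm x * norm q ^ n \<le> 1" "x \<noteq> 0" for x n
    using that
  proof (induction n arbitrary: x)
    case 0
    thus ?case using inner' by simp
  next
    case (Suc n)
    show ?case
    proof (cases "norm x \<le> 1")
      case True
      thus ?thesis using inner' Suc.prems by simp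
    next
      case False
      have "norm (f (q * x)) \<le> B"
        using Suc.prems q0 by (intro Suc.IH) (auto simp: norm_mult mult_ac)
      moreover have "norm (f (q * x)) = norm x * norm (f x)"
        using shift[OF Suc.prems(2)] by (simp add: norm_mult)
      moreover have "1 * norm (f x) \<le> norm x * norm (f x)"
        using False by (intro mult_right_mono) auto
      ultimately show ?thesis by linarith
    qed
  qed
  have bound: "norm (f x) \<le> B" if "x \<noteq> 0" for x
  proof -
    have pos: "0 < norm x" using that by simp
    hence "0 < 1 / norm x" by simp
    then obtain n where "norm q ^ n < 1 / norm x"
      using real_arch_pow_inv q(2) by blast
    hence "norm x * norm q ^ n \<le> 1"
      using pos by (simp add: field_simps)
    thus ?thesis
      using that by (rule outer)
  qed
  have "\<exists>g. g holomorphic_on UNIV \<and> (\<forall>z\<in>UNIV - {0}. g z = f z)"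
    using hol bound
    by (subst holomorphic_on_extend_bounded) (auto simp: Compl_eq_Diff_UNIV eventually_at_filter intro!: exI[of _ B])
  then obtain g where g: "g holomorphic_on UNIV" "\<And>z. z \<noteq> 0 \<Longrightarrow> g z = f z"
    by auto
  have "norm (g z) \<le> max B (norm (g 0))" for z
    using bound[of z] g(2)[of z] by (cases "z = 0") auto
  hence "bounded (range g)"
    by (auto simp: bounded_iff)
  hence "g constant_on UNIV"
    by (rule Liouville_theorem[OF g(1)])
  then obtain c where c: "\<And>z. g z = c"
    by (auto simp: constant_on_def)
  \<comment> \<open>The shift equation at the point 1 reads f(q) = -f(1).\<close>
  have "c = - c"
    using shift[of 1] g(2)[of 1] g(2)[of q] q0 by (simp add: c)
  thus ?thesis
    using g(2)[OF a] by (simp add: c)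
qed

text \<open>Since \<open>B\<close> vanishes at \<open>z\<close>, B(a)/(a - z) is a difference
  quotient and tends to B'(z). Nothing is said about the value of \<open>f\<close> at
  \<open>z\<close>, which is accidental in the applications.\<close>

lemma simple_pole_cancel_limit:
  fixes A B f :: "complex \<Rightarrow> complex"
  assumes "A analytic_on {z}" "B analytic_on {z}" "B z = 0"
    and eq: "\<forall>\<^sub>F a in at z. f a = A a + B a / (a - z)"
  shows "\<exists>c. f \<midarrow>z\<rightarrow> c"
proof -
  have "(B has_field_derivative deriv B z) (at z)"
    using assms(2) analytic_on_imp_differentiable_at field_differentiable_derivI by blast
  hence "(\<lambda>a. B a / (a - z)) \<midarrow>z\<rightarrow> deriv B z"
    using assms(3) by (simp add: has_field_derivative_iff)
  moreover have "A \<midarrow>z\<rightarrow> A z"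
    using assms(1) by (simp add: analytic_at_imp_isCont isContD)
  ultimately have "(\<lambda>a. A a + B a / (a - z)) \<midarrow>z\<rightarrow> A z + deriv B z"
    by (rule tendsto_add[rotated])
  hence "f \<midarrow>z\<rightarrow> A z + deriv B z"
    using eq by (simp cong: tendsto_cong)
  thus ?thesis ..
qed

lemma qpoch_inf_analytic:
  assumes "norm q < 1" "f analytic_on A"
  shows "(\<lambda>x. qpoch_inf (f x) q) analytic_on A"
proof -
  have "(\<lambda>x. qpoch_inf x q) analytic_on UNIV"
    using qpoch_inf_holomorphic_UNIV[OF assms(1)] by (simp add: analytic_on_open)
  from analytic_on_compose_gen[OF assms(2) this] show ?thesis
    by (simp add: o_def)
qed

lemma theta_j_analytic:
  assumes "norm q < 1" "f analytic_on A" "\<And>x. x \<in> A \<Longrightarrow> f x \<noteq> 0"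
  shows "(\<lambda>x. theta_j (f x) q) analytic_on A"
  unfolding theta_j_def using assms by (intro analytic_intros qpoch_inf_analytic) auto

lemma power_int_eq_1_iff_norm:
  fixes q :: complex
  assumes "0 < norm q" "norm q < 1"
  shows "q powi k = 1 \<longleftrightarrow> k = 0"
proof
  assume *: "q powi k = 1"
  have "q ^ nat \<bar>k\<bar> = 1"
  proof (cases "k \<ge> 0")
    case True
    thus ?thesis using * by (simp add: power_int_def)
  next
    case False
    hence "inverse (q ^ nat (- k)) = 1"
      using * by (simp add: power_int_def power_inverse)
    thus ?thesis using False by simp
  qed
  thus "k = 0"
    using norm_power_neq_1[OF assms(2), of "nat \<bar>k\<bar>"] by (cases "k = 0") auto
qed simp

lemma power_int_inject_norm:
  fixes q :: complex
  assumes "0 < norm q" "norm q < 1"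
  shows "q powi k = q powi l \<longleftrightarrow> k = l"
proof -
  have "q \<noteq> 0" using assms by auto
  hence "q powi k = q powi l \<longleftrightarrow> q powi (k - l) = 1"
    by (simp add: power_int_diff)
  thus ?thesis
    unfolding power_int_eq_1_iff_norm[OF assms] by simp
qed

section \<open>Theta constants as quotients of J_1, J_2, J_4\<close>

lemma eta_nonzero:
  assumes "norm q < 1" "n > 0"
  shows "qpoch_inf (q ^ n) (q ^ n) \<noteq> 0"
proof -
  have "norm (q ^ n) < 1"
    using assms by (simp add: norm_power power_less_one_iff)
  thus ?thesis by (intro qpoch_inf_nonzero')
qed

lemma qpoch_inf_minus_q:
  assumes "norm q < 1"
  shows "qpoch_inf (- q) q = qpoch_inf (q\<^sup>2) (q\<^sup>2) / qpoch_inf q q"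
  using qpoch_inf_mult_minus[OF assms, of q] eta_nonzero[OF assms, of 1] by (simp add: field_simps)

lemma theta_j_minus_1_eta:
  assumes "norm q < 1"
  shows "theta_j (-1) q = 2 * qpoch_inf (q\<^sup>2) (q\<^sup>2) ^ 2 / qpoch_inf q q"
proof -
  have "theta_j (-1) q = 2 * qpoch_inf (- q) q ^ 2 * qpoch_inf q q"
    unfolding theta_j_def using qpoch_inf_step[OF assms, of "-1"] by (simp add: power2_eq_square)
  thus ?thesis
    unfolding qpoch_inf_minus_q[OF assms] using eta_nonzero[OF assms, of 1]
    by (simp add: field_simps power2_eq_square)
qed

text \<open>Splitting (-q;q)_inf by the parity of the exponent gives (-q;q^2)_inf (-q^2;q^2)_inf,
  and \<open>qpoch_inf_minus_q\<close> evaluates everything but the factor sought.\<close>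

lemma qpoch_inf_minus_q_base_q2:
  assumes "norm q < 1"
  shows "qpoch_inf (- q) (q\<^sup>2)
           = qpoch_inf (q\<^sup>2) (q\<^sup>2) ^ 2 / (qpoch_inf q q * qpoch_inf (q ^ 4) (q ^ 4))"
proof -
  have q2: "norm (q\<^sup>2) < 1"
    using assms by (simp add: norm_power power_less_one_iff)
  have q4: "(q\<^sup>2)\<^sup>2 = q ^ 4"
    by (simp flip: power_mult)
  have 1: "qpoch_inf (- q) q = qpoch_inf (- q) (q\<^sup>2) * qpoch_inf (- (q\<^sup>2)) (q\<^sup>2)"
    using qpoch_inf_bisect[OF assms, of "-q"] by (simp add: power2_eq_square)
  have 2: "qpoch_inf (- (q\<^sup>2)) (q\<^sup>2) = qpoch_inf (q ^ 4) (q ^ 4) / qpoch_inf (q\<^sup>2) (q\<^sup>2)"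
    using qpoch_inf_minus_q[OF q2] unfolding q4 .
  show ?thesis
    using 1 eta_nonzero[OF assms, of 1] eta_nonzero[OF assms, of 2] eta_nonzero[OF assms, of 4]
    unfolding 2 qpoch_inf_minus_q[OF assms] by (simp add: field_simps power2_eq_square)
qed

text \<open>Here q^4/(-q) = -q^3, so the first two products run over the exponents 1 and 3 modulo 4
  and merge into (-q;q^2)_inf.\<close>

lemma theta_j_minus_q_base_q4:
  assumes "0 < norm q" "norm q < 1"
  shows "theta_j (- q) (q ^ 4) = qpoch_inf (q\<^sup>2) (q\<^sup>2) ^ 2 / qpoch_inf q q"
proof -
  have q0: "q \<noteq> 0" using assms by auto
  have q2: "norm (q\<^sup>2) < 1"
    using assms by (simp add: norm_power power_less_one_iff)
  have q4: "(q\<^sup>2)\<^sup>2 = q ^ 4"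
    by (simp flip: power_mult)
  have "q ^ 4 / (- q) = - q * q\<^sup>2"
    using q0 by (simp add: field_simps power2_eq_square power4_eq_xxxx)
  hence "theta_j (- q) (q ^ 4) = qpoch_inf (- q) (q\<^sup>2) * qpoch_inf (q ^ 4) (q ^ 4)"
    unfolding theta_j_def using qpoch_inf_bisect[OF q2, of "-q"] unfolding q4 by simp
  thus ?thesis
    unfolding qpoch_inf_minus_q_base_q2[OF assms(2)]
    using eta_nonzero[OF assms(2), of 4] by simp
qed

section \<open>The difference of the two sides and its shift equation\<close>

definition mock_rhs :: "complex \<Rightarrow> complex \<Rightarrow> complex" where
  "mock_rhs q a = 2 * appell_lerch_m a (q\<^sup>2) (-1)
           - theta_j (a * q) (q\<^sup>2) / theta_j (- q) (q ^ 4) * appell_lerch_m a q (-1)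
           - 1 / 2 * (J q 1 ^ 5 / J q 2 ^ 4) * (theta_j (a * q) (q\<^sup>2) / theta_j (- a) q)"

definition mock_diff :: "complex \<Rightarrow> complex \<Rightarrow> complex" where
  "mock_diff q a = mock_sum q a - mock_rhs q a"

context
  fixes q :: complex
  assumes q: "0 < norm q" "norm q < 1"
begin

lemma nome_nonzero: "q \<noteq> 0"
  using q by auto

lemma norm_nome_square: "0 < norm (q\<^sup>2)" "norm (q\<^sup>2) < 1"
  using q by (simp_all add: norm_power power_less_one_iff)

lemma generic_base_q2:
  assumes "\<And>k::int. a \<noteq> - (q powi k)"
  shows "a \<noteq> - (q\<^sup>2 powi k)"
proof -
  have "q\<^sup>2 powi k = q powi (2 * k)"
    by (simp add: power_int_mult)
  thus ?thesis using assms by metis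
qed

lemma generic_shift:
  assumes "\<And>k::int. a \<noteq> - (q powi k)"
  shows "q * a \<noteq> - (q powi k)"
proof
  assume "q * a = - (q powi k)"
  hence "a = - (q powi (k - 1))"
    using nome_nonzero by (simp add: power_int_diff field_simps)
  thus False using assms by metis
qed

lemma theta_j_minus_nonzero:
  assumes "a \<noteq> 0" "\<And>k::int. a \<noteq> - (q powi k)"
  shows "theta_j (- a) q \<noteq> 0"
proof (rule theta_j_nonzero[OF q])
  show "- a \<noteq> q powi k" for k
    using assms(2)[of k] by (metis minus_minus)
qed (use assms in simp)

text \<open>Under a -> q^2 a, \<open>T\<close> gets the factor -1/(aq) and \<open>V\<close> the
  factor 1/(q a^2), so \<open>T / V\<close> is multiplied by -a. Two shifts with base
  \<open>q\<close> turn \<open>m\<close> into 1 - qa + q a^2 m, which times -1/(aq) is -(1/(aq) - 1)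
  - a m. The inhomogeneous parts are then those of \<open>mock_sum_shift\<close>.\<close>

lemma mock_diff_shift_generic:
  assumes a: "a \<noteq> 0" and generic: "\<And>k::int. a \<noteq> - (q powi k)"
  shows "mock_diff q (q\<^sup>2 * a) = - a * mock_diff q a"
proof -
  define T where "T = theta_j (a * q) (q\<^sup>2)"
  define j4 where "j4 = theta_j (- q) (q ^ 4)"
  define V where "V = theta_j (- a) q"
  define M where "M = appell_lerch_m a (q\<^sup>2) (-1)"
  define m where "m = appell_lerch_m a q (-1)"
  define c where "c = 1 / 2 * (J q 1 ^ 5 / J q 2 ^ 4)"
  have T: "theta_j (q\<^sup>2 * a * q) (q\<^sup>2) = - T / (a * q)"
    using theta_j_shift[OF norm_nome_square, of "a * q"] a nome_nonzero by (simp add: T_def mult_ac)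
  have "theta_j (q * (- a)) q = V / a"
    using theta_j_shift[OF q, of "- a"] a by (simp add: V_def)
  hence V: "theta_j (- (q\<^sup>2 * a)) q = V / (q * a\<^sup>2)"
    using theta_j_shift[OF q, of "q * (- a)"] a nome_nonzero by (simp add: power2_eq_square mult_ac)
  have V0: "V \<noteq> 0"
    unfolding V_def by (rule theta_j_minus_nonzero[OF a generic])
  have M: "appell_lerch_m (q\<^sup>2 * a) (q\<^sup>2) (-1) = 1 - a * M"
    unfolding M_def by (intro appell_lerch_shift norm_nome_square a generic_base_q2 generic)
  have m: "appell_lerch_m (q\<^sup>2 * a) q (-1) = 1 - q * a * (1 - a * m)"
    using appell_lerch_shift[OF q, of "q * a"] appell_lerch_shift[OF q a generic] generic_shift[OF generic] a nome_nonzero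
    by (simp add: m_def power2_eq_square mult_ac)
  have "q\<^sup>2 / (a * q) = q / a"
    using nome_nonzero by (simp add: power2_eq_square)
  hence T': "T = qpoch_inf (a * q) (q\<^sup>2) * qpoch_inf (q / a) (q\<^sup>2) * qpoch_inf (q\<^sup>2) (q\<^sup>2)"
    unfolding T_def theta_j_def by simp
  have "qpoch_inf (a * q) (q\<^sup>2) * qpoch_inf (q / a) (q\<^sup>2) / qpoch_inf (- q) q = T / j4"
    unfolding T' j4_def theta_j_minus_q_base_q4[OF q] qpoch_inf_minus_q[OF q(2)]
    using eta_nonzero[OF q(2), of 1] eta_nonzero[OF q(2), of 2]
    by (simp add: field_simps power2_eq_square)
  hence L: "mock_sum q (q\<^sup>2 * a) = 2 + (1 / (a * q) - 1) * (T / j4) - a * mock_sum q a"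
    using mock_sum_shift[OF q(2) nome_nonzero a] by (simp add: algebra_simps)
  have R: "mock_rhs q a = 2 * M - T / j4 * m - c * (T / V)"
    unfolding mock_rhs_def M_def T_def j4_def m_def c_def V_def ..
  have R': "mock_rhs q (q\<^sup>2 * a)
      = 2 * (1 - a * M) - (- T / (a * q)) / j4 * (1 - q * a * (1 - a * m)) - c * ((- T / (a * q)) / (V / (q * a\<^sup>2)))"
    unfolding mock_rhs_def T V M m j4_def c_def ..
  have e1: "(- T / (a * q)) / (V / (q * a\<^sup>2)) = - a * (T / V)"
    using a nome_nonzero V0 by (simp add: field_simps power2_eq_square)
  have e2: "(- T / (a * q)) / j4 * (1 - q * a * (1 - a * m)) = - (1 / (a * q) - 1) * (T / j4) - a * (T / j4 * m)"
    using a nome_nonzero by (cases "j4 = 0") (simp_all add: field_simps)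
  show ?thesis
    unfolding mock_diff_def L R R' e1 e2 by (simp add: algebra_simps)
qed

lemma punctured_ball_generic:
  assumes "z \<noteq> 0"
  obtains r where "r > 0" "\<And>a. a \<in> ball z r - {z} \<Longrightarrow> a \<noteq> 0"
    "\<And>a k. a \<in> ball z r - {z} \<Longrightarrow> a \<noteq> - (q powi k)"
proof -
  obtain \<eta> where \<eta>: "\<eta> > 0" "\<And>k. z \<noteq> - (q powi k) \<Longrightarrow> 2 * \<eta> \<le> norm (z + q powi k)"
    using int_powers_discrete[OF q assms] by blast
  show ?thesis
  proof (rule that[of "min \<eta> (norm z)"])
    show "min \<eta> (norm z) > 0"
      using \<eta> assms by simp
    show "a \<noteq> 0" if "a \<in> ball z (min \<eta> (norm z)) - {z}" for a
      using that by (auto simp: dist_norm)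
    show "a \<noteq> - (q powi k)" if "a \<in> ball z (min \<eta> (norm z)) - {z}" for a k
    proof
      assume a: "a = - (q powi k)"
      hence "2 * \<eta> \<le> norm (z + q powi k)"
        using that by (intro \<eta>) auto
      moreover have "norm (z + q powi k) < \<eta>"
        using that by (simp add: a dist_norm)
      ultimately show False using \<eta>(1) by simp
    qed
  qed
qed

lemma eventually_generic:
  assumes "z \<noteq> 0"
  shows "\<forall>\<^sub>F a in at z. a \<noteq> 0 \<and> (\<forall>k::int. a \<noteq> - (q powi k))"
proof -
  obtain r where r: "r > 0" "\<And>a. a \<in> ball z r - {z} \<Longrightarrow> a \<noteq> 0"
    "\<And>a k. a \<in> ball z r - {z} \<Longrightarrow> a \<noteq> - (q powi k)"
    using punctured_ball_generic[OF assms] by blast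
  have "\<forall>\<^sub>F a in at z. a \<in> ball z r - {z}"
    using r(1) by (intro eventually_at_in_open) auto
  thus ?thesis
    by eventually_elim (use r in blast)
qed

lemma appell_lerch_m_analytic:
  assumes "z \<noteq> 0" "\<And>k::int. z \<noteq> - (q powi k)"
  shows "(\<lambda>a. appell_lerch_m a q (-1)) analytic_on {z}"
  unfolding appell_lerch_m_minus_1
  by (intro analytic_intros appell_sum_analytic q assms theta_j_minus_1_nonzero)

end

text \<open>A second context, because facts of the first one are used for the base q^2 as well as
  for \<open>q\<close>; once it is closed, they hold for every base.\<close>

context
  fixes q :: complex
  assumes q: "0 < norm q" "norm q < 1"
begin

section \<open>Singularities of the difference and their removal\<close>

lemma mock_theta_analytic:
  assumes "z \<noteq> 0"
  shows "(\<lambda>a. theta_j (a * q) (q\<^sup>2)) analytic_on {z}"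
  using assms nome_nonzero[OF q] by (intro theta_j_analytic norm_nome_square[OF q] analytic_intros) auto

lemma mock_diff_analytic:
  assumes z: "z \<noteq> 0" and generic: "\<And>k::int. z \<noteq> - (q powi k)"
  shows "mock_diff q analytic_on {z}"
proof -
  have j4: "theta_j (- q) (q ^ 4) \<noteq> 0"
    unfolding theta_j_minus_q_base_q4[OF q]
    using eta_nonzero[OF q(2), of 1] eta_nonzero[OF q(2), of 2] by simp
  have V: "theta_j (- z) q \<noteq> 0"
    by (rule theta_j_minus_nonzero[OF q z generic])
  have V': "(\<lambda>a. theta_j (- a) q) analytic_on {z}"
    using z by (intro theta_j_analytic q analytic_intros) auto
  show ?thesis
    unfolding mock_diff_def mock_rhs_def using j4 V
    by (intro analytic_intros mock_sum_analytic mock_theta_analytic V'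
          appell_lerch_m_analytic[OF q] appell_lerch_m_analytic[OF norm_nome_square[OF q]] generic_base_q2[OF q] q z generic)
       auto
qed

lemma mock_diff_isolated:
  assumes "z \<noteq> 0"
  shows "isolated_singularity_at (mock_diff q) z"
proof -
  obtain r where r: "r > 0" "\<And>a. a \<in> ball z r - {z} \<Longrightarrow> a \<noteq> 0"
    "\<And>a k. a \<in> ball z r - {z} \<Longrightarrow> a \<noteq> - (q powi k)"
    using punctured_ball_generic[OF q assms] by blast
  have "mock_diff q analytic_on ball z r - {z}"
    unfolding analytic_on_analytic_at[of _ "ball z r - {z}"]
    using r by (blast intro: mock_diff_analytic)
  thus ?thesis
    unfolding isolated_singularity_at_def using r(1) by blast
qed

lemma mock_diff_limit_minus_1: "\<exists>c. mock_diff q \<midarrow>-1\<rightarrow> c"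
proof -
  define E1 E2 E4 where "E1 = qpoch_inf q q" and "E2 = qpoch_inf (q\<^sup>2) (q\<^sup>2)" and "E4 = qpoch_inf (q ^ 4) (q ^ 4)"
  have E: "E1 \<noteq> 0" "E2 \<noteq> 0" "E4 \<noteq> 0"
    using eta_nonzero[OF q(2), of 1] eta_nonzero[OF q(2), of 2] eta_nonzero[OF q(2), of 4]
    by (simp_all add: E1_def E2_def E4_def)
  define t u where "t = theta_j (-1) q" and "u = theta_j (-1) (q\<^sup>2)"
  define T where "T = (\<lambda>a. theta_j (a * q) (q\<^sup>2))"
  define j4 where "j4 = theta_j (- q) (q ^ 4)"
  define c where "c = 1 / 2 * (J q 1 ^ 5 / J q 2 ^ 4)"
  \<comment> \<open>\<open>K\<close> is j(-a;q) without the factor 1 + a that vanishes at -1. For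
    either base the Appell-Lerch term singular at -1 is the one with index 1, namely 1/(1 + a),
    which \<open>S\<close> and \<open>S'\<close> omit.\<close>
  define K where "K = (\<lambda>a. qpoch_inf (- a * q) q * qpoch_inf (q / (- a)) q * E1)"
  define S S' where "S = appell_sum (- {1}) q" and "S' = appell_sum (- {1}) (q\<^sup>2)"
  define A where "A = (\<lambda>a. mock_sum q a - 2 * (S' a / u) + T a / j4 * (S a / t))"
  define B where "B = (\<lambda>a. - 2 / u + T a / j4 / t + c * (T a / K a))"
  have neg_1: "- 1 \<noteq> (0 :: complex)" by simp
  have q4: "(q\<^sup>2)\<^sup>2 = q ^ 4"
    by (simp flip: power_mult)
  have t: "t = 2 * E2 ^ 2 / E1"
    unfolding t_def theta_j_minus_1_eta[OF q(2)] E1_def E2_def ..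
  have u: "u = 2 * E4 ^ 2 / E2"
    unfolding u_def theta_j_minus_1_eta[OF norm_nome_square(2)[OF q]] E4_def E2_def q4 ..
  have j4: "j4 = E2 ^ 2 / E1"
    unfolding j4_def theta_j_minus_q_base_q4[OF q] E1_def E2_def ..
  have c: "c = 1 / 2 * (E1 ^ 5 / E2 ^ 4)"
    by (simp add: c_def J_def E1_def E2_def)
  have Km1: "K (-1) = E1 ^ 3"
    by (simp add: K_def E1_def power3_eq_cube)
  have "q\<^sup>2 / (- q) = - q"
    using nome_nonzero[OF q] by (simp add: power2_eq_square)
  hence "T (-1) = qpoch_inf (- q) (q\<^sup>2) ^ 2 * E2"
    by (simp add: T_def theta_j_def E2_def power2_eq_square[of "qpoch_inf _ _"])
  hence T: "T (-1) = E2 ^ 5 / (E1 ^ 2 * E4 ^ 2)"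
    unfolding qpoch_inf_minus_q_base_q2[OF q(2)] E1_def[symmetric] E2_def[symmetric] E4_def[symmetric]
    using E by (simp add: field_simps power2_eq_square eval_nat_numeral)
  have T_ana: "T analytic_on {-1}"
    unfolding T_def by (intro mock_theta_analytic) auto
  have S_ana: "S analytic_on {-1}" "S' analytic_on {-1}"
    unfolding S_def S'_def
    by (intro appell_sum_analytic q norm_nome_square[OF q];
        auto simp: minus_equation_iff power_int_eq_1_iff_norm[OF q] power_int_eq_1_iff_norm[OF norm_nome_square[OF q]])+
  have K_ana: "K analytic_on {-1}"
    unfolding K_def by (intro analytic_intros qpoch_inf_analytic q) auto
  have tuj: "t \<noteq> 0" "u \<noteq> 0" "j4 \<noteq> 0"
    unfolding t u j4 using E by auto
  show ?thesis
  proof (rule simple_pole_cancel_limit[of A _ B])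
    show "A analytic_on {-1}"
      unfolding A_def using tuj by (intro analytic_intros mock_sum_analytic q T_ana S_ana) auto
    show "B analytic_on {-1}"
      unfolding B_def using tuj Km1 E by (intro analytic_intros T_ana K_ana) auto
    \<comment> \<open>The first contribution is -E2/E4^2, and the other two are E2/(2 E4^2)
      each.\<close>
    show "B (-1) = 0"
      unfolding B_def Km1 T t u j4 c using E by (simp add: field_simps eval_nat_numeral)
    show "\<forall>\<^sub>F a in at (-1). mock_diff q a = A a + B a / (a - (-1))"
      using eventually_generic[OF q neg_1]
    proof eventually_elim
      case (elim a)
      hence a: "a \<noteq> 0" and generic: "\<And>k::int. a \<noteq> - (q powi k)" by auto
      have a1: "1 + a \<noteq> 0"
        using generic[of 0] by (simp add: add_eq_0_iff)
      have m: "appell_lerch_m a q (-1) = (1 / (1 + a) + S a) / t"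
        unfolding appell_lerch_m_minus_1 appell_sum_split[OF q a generic, of 1] by (simp add: S_def t_def)
      have M: "appell_lerch_m a (q\<^sup>2) (-1) = (1 / (1 + a) + S' a) / u"
        unfolding appell_lerch_m_minus_1 appell_sum_split[OF norm_nome_square[OF q] a generic_base_q2[OF q generic], of 1]
        by (simp add: S'_def u_def)
      have V: "theta_j (- a) q = (1 + a) * K a"
        unfolding theta_j_def K_def using qpoch_inf_step[OF q(2), of "- a"] by (simp add: E1_def)
      have gen: "L - (2 * ((1 / w + s') / u) - x / j4 * ((1 / w + s) / t) - c * (x / (w * k)))
          = (L - 2 * (s' / u) + x / j4 * (s / t)) + (- 2 / u + x / j4 / t + c * (x / k)) / w" for L w s s' x k
        by (simp add: algebra_simps add_divide_distrib diff_divide_distrib)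
      show ?case
        unfolding mock_diff_def mock_rhs_def m M V A_def B_def j4_def[symmetric] c_def[symmetric]
        using gen[of "mock_sum q a" "1 + a" "S' a" "T a" "S a" "K a"] by (simp add: T_def add.commute)
    qed
  qed
qed

lemma mock_diff_limit_minus_q: "\<exists>c. mock_diff q \<midarrow>-q\<rightarrow> c"
proof -
  have q0: "q \<noteq> 0" by (rule nome_nonzero[OF q])
  hence neg_q: "- q \<noteq> 0" by simp
  define E1 E2 where "E1 = qpoch_inf q q" and "E2 = qpoch_inf (q\<^sup>2) (q\<^sup>2)"
  have E: "E1 \<noteq> 0" "E2 \<noteq> 0"
    using eta_nonzero[OF q(2), of 1] eta_nonzero[OF q(2), of 2]
    by (simp_all add: E1_def E2_def)
  define t where "t = theta_j (-1) q"
  define T where "T = (\<lambda>a. theta_j (a * q) (q\<^sup>2))"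
  define j4 where "j4 = theta_j (- q) (q ^ 4)"
  define c where "c = 1 / 2 * (J q 1 ^ 5 / J q 2 ^ 4)"
  \<comment> \<open>Now the vanishing factor 1 - q/(-a) = (a + q)/a sits in the second product, and
    \<open>K\<close> keeps its 1/a. The singular term of base \<open>q\<close> has index 0 and
    equals q/(a + q); base q^2 has poles at even powers only, so \<open>M\<close> goes entirely into
    \<open>A\<close>.\<close>
  define K where "K = (\<lambda>a. qpoch_inf (- a) q * qpoch_inf (q / (- a) * q) q * E1 / a)"
  define S where "S = appell_sum (- {0}) q"
  define M where "M = (\<lambda>a. appell_lerch_m a (q\<^sup>2) (-1))"
  define A where "A = (\<lambda>a. mock_sum q a - 2 * M a + T a / j4 * (S a / t))"
  define B where "B = (\<lambda>a. T a / j4 * q / t + c * (T a / K a))"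
  have t: "t = 2 * E2 ^ 2 / E1"
    unfolding t_def theta_j_minus_1_eta[OF q(2)] E1_def E2_def ..
  have j4: "j4 = E2 ^ 2 / E1"
    unfolding j4_def theta_j_minus_q_base_q4[OF q] E1_def E2_def ..
  have c: "c = 1 / 2 * (E1 ^ 5 / E2 ^ 4)"
    by (simp add: c_def J_def E1_def E2_def)
  have Kmq: "K (-q) = - (E1 ^ 3) / q"
    using q0 by (simp add: K_def E1_def power3_eq_cube)
  have T_ana: "T analytic_on {-q}"
    unfolding T_def using q0 by (intro mock_theta_analytic) auto
  have S_ana: "S analytic_on {-q}"
  proof -
    have "- q \<noteq> - (q powi (1 - r))" if "r \<in> - {0}" for r
      using that power_int_inject_norm[OF q, of 1 "1 - r"] by simp
    thus ?thesis unfolding S_def using q0 by (intro appell_sum_analytic q) auto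
  qed
  have M_ana: "M analytic_on {-q}"
  proof -
    have "- q \<noteq> - (q\<^sup>2 powi k)" for k
    proof -
      have "q\<^sup>2 powi k = q powi (2 * k)"
        by (simp add: power_int_mult)
      moreover have "q powi 1 \<noteq> q powi (2 * k)"
        unfolding power_int_inject_norm[OF q] by presburger
      ultimately show ?thesis by simp
    qed
    thus ?thesis unfolding M_def using q0 by (intro appell_lerch_m_analytic norm_nome_square[OF q]) auto
  qed
  have K_ana: "K analytic_on {-q}"
    unfolding K_def using q0 by (intro analytic_intros qpoch_inf_analytic q) auto
  have tj: "t \<noteq> 0" "j4 \<noteq> 0"
    unfolding t j4 using E by auto
  show ?thesis
  proof (rule simple_pole_cancel_limit[of A _ B])
    show "A analytic_on {-q}"
      unfolding A_def using tj q0 by (intro analytic_intros mock_sum_analytic q T_ana S_ana M_ana) auto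
    show "B analytic_on {-q}"
      unfolding B_def using tj Kmq E q0 by (intro analytic_intros T_ana K_ana) auto
    \<comment> \<open>\<open>T (-q)\<close> is a common factor and stays unevaluated. What remains
      is q/(j4 t) + c/K(-q) = 0, that is, c = E1^5/(2 E2^4): the origin of the coefficient in the
      theorem.\<close>
    show "B (-q) = 0"
      unfolding B_def Kmq t j4 c using E q0 by (simp add: field_simps eval_nat_numeral)
    show "\<forall>\<^sub>F a in at (-q). mock_diff q a = A a + B a / (a - (-q))"
      using eventually_generic[OF q neg_q]
    proof eventually_elim
      case (elim a)
      hence a: "a \<noteq> 0" and generic: "\<And>k::int. a \<noteq> - (q powi k)" by auto
      have m: "appell_lerch_m a q (-1) = (q / (a + q) + S a) / t"
      proof -
        have "1 / (1 + inverse q * a) = q / (a + q)"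
          using q0 by (simp add: field_simps)
        thus ?thesis
          unfolding appell_lerch_m_minus_1 appell_sum_split[OF q a generic, of 0] by (simp add: S_def t_def)
      qed
      have "1 - q / (- a) = (a + q) / a"
        using a by (simp add: field_simps)
      hence V: "theta_j (- a) q = (a + q) * K a"
        unfolding theta_j_def K_def using qpoch_inf_step[OF q(2), of "q / (- a)"] by (simp add: E1_def)
      have gen: "L - (2 * M' - x / j4 * ((q / w + s) / t) - c * (x / (w * k)))
          = (L - 2 * M' + x / j4 * (s / t)) + (x / j4 * q / t + c * (x / k)) / w" for L M' w s x k
        by (simp add: algebra_simps add_divide_distrib diff_divide_distrib)
      show ?case
        unfolding mock_diff_def mock_rhs_def m V A_def B_def M_def j4_def[symmetric] c_def[symmetric]
        using gen[of "mock_sum q a" "M a" "T a" "a + q" "S a" "K a"] by (simp add: T_def M_def)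
    qed
  qed
qed

text \<open>The shift equation is available only at generic points, so what travels from
  \<open>z\<close> to q^2 z is a limit, by the substitution a = x/q^2 in a punctured
  neighbourhood.\<close>

lemma mock_diff_limit_up:
  assumes z: "z \<noteq> 0" and lim: "mock_diff q \<midarrow>z\<rightarrow> c"
  shows "mock_diff q \<midarrow>q\<^sup>2 * z\<rightarrow> - z * c"
proof -
  have q0: "q \<noteq> 0" by (rule nome_nonzero[OF q])
  have ev: "\<forall>\<^sub>F a in at z. mock_diff q (q\<^sup>2 * a) = - a * mock_diff q a"
    using eventually_generic[OF q z] by eventually_elim (rule mock_diff_shift_generic[OF q]; blast)
  have "(\<lambda>a. - a * mock_diff q a) \<midarrow>z\<rightarrow> - z * c"
    by (intro tendsto_intros lim)
  hence lim': "(\<lambda>a. mock_diff q (q\<^sup>2 * a)) \<midarrow>z\<rightarrow> - z * c"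
    using tendsto_cong[OF ev] by blast
  have "filterlim (\<lambda>x. x / q\<^sup>2) (at z) (at (q\<^sup>2 * z))"
  proof (rule filterlim_atI)
    show "((\<lambda>x. x / q\<^sup>2) \<longlongrightarrow> z) (at (q\<^sup>2 * z))"
      using q0 by (auto intro!: tendsto_eq_intros)
    show "\<forall>\<^sub>F x in at (q\<^sup>2 * z). x / q\<^sup>2 \<noteq> z"
      using q0 by (auto simp: eventually_at_filter field_simps)
  qed
  from filterlim_compose[OF lim' this] show ?thesis
    using q0 by simp
qed

lemma mock_diff_limit_down:
  assumes z: "z \<noteq> 0" and lim: "mock_diff q \<midarrow>q\<^sup>2 * z\<rightarrow> c"
  shows "mock_diff q \<midarrow>z\<rightarrow> - c / z"
proof -
  have q0: "q \<noteq> 0" by (rule nome_nonzero[OF q])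
  have ev: "\<forall>\<^sub>F a in at z. - mock_diff q (q\<^sup>2 * a) / a = mock_diff q a"
    using eventually_generic[OF q z] by eventually_elim (auto simp: mock_diff_shift_generic[OF q])
  have "filterlim (\<lambda>x. q\<^sup>2 * x) (at (q\<^sup>2 * z)) (at z)"
  proof (rule filterlim_atI)
    show "((\<lambda>x. q\<^sup>2 * x) \<longlongrightarrow> q\<^sup>2 * z) (at z)"
      by (intro tendsto_intros)
    show "\<forall>\<^sub>F x in at z. q\<^sup>2 * x \<noteq> q\<^sup>2 * z"
      using q0 by (auto simp: eventually_at_filter)
  qed
  from filterlim_compose[OF lim this]
  have "(\<lambda>a. - mock_diff q (q\<^sup>2 * a) / a) \<midarrow>z\<rightarrow> - c / z"
    using z by (intro tendsto_intros) auto
  thus ?thesis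
    using ev by (simp cong: tendsto_cong)
qed

text \<open>Multiplication by q^2 preserves the parity of k in -q^k, so the two starting points -1
  and -q reach all singular points.\<close>

lemma mock_diff_limit_power:
  assumes "z \<noteq> 0" "\<exists>c. mock_diff q \<midarrow>z\<rightarrow> c"
  shows "\<exists>c. mock_diff q \<midarrow>q powi (2 * k) * z\<rightarrow> c"
proof (induction k rule: int_induct[of _ 0])
  case base
  show ?case using assms by simp
next
  case (step1 i)
  have "q powi (2 * (i + 1)) * z = q\<^sup>2 * (q powi (2 * i) * z)"
    using nome_nonzero[OF q] by (simp add: distrib_left power_int_add mult_ac)
  moreover have "q powi (2 * i) * z \<noteq> 0"
    using nome_nonzero[OF q] assms(1) by simp
  ultimately show ?case
    using step1 mock_diff_limit_up by metis
next
  case (step2 i)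
  have "q\<^sup>2 * (q powi (2 * (i - 1)) * z) = q powi (2 * i) * z"
    using nome_nonzero[OF q] by (simp add: right_diff_distrib power_int_diff)
  moreover have "q powi (2 * (i - 1)) * z \<noteq> 0"
    using nome_nonzero[OF q] assms(1) by simp
  ultimately show ?case
    using step2 mock_diff_limit_down by metis
qed

lemma mock_diff_limit:
  assumes z: "z \<noteq> 0"
  shows "\<exists>c. mock_diff q \<midarrow>z\<rightarrow> c"
proof (cases "\<exists>k::int. z = - (q powi k)")
  case False
  hence "mock_diff q analytic_on {z}"
    using z by (intro mock_diff_analytic) auto
  hence "mock_diff q \<midarrow>z\<rightarrow> mock_diff q z"
    by (simp add: analytic_at_imp_isCont isContD)
  thus ?thesis ..
next
  case True
  then obtain k :: int where k: "z = - (q powi k)" by blast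
  show ?thesis
  proof (cases "even k")
    case True
    then obtain l where "k = 2 * l" by (elim evenE)
    hence "z = q powi (2 * l) * (-1)" using k by simp
    thus ?thesis
      using mock_diff_limit_power[of "-1" l] mock_diff_limit_minus_1 by simp
  next
    case False
    then obtain l where "k = 2 * l + 1" by (elim oddE)
    hence "z = q powi (2 * l) * (-q)" using k nome_nonzero[OF q] by (simp add: power_int_add)
    thus ?thesis
      using mock_diff_limit_power[of "-q" l] mock_diff_limit_minus_q nome_nonzero[OF q] by simp
  qed
qed

lemma mock_diff_eq_0:
  assumes "a \<noteq> 0" "\<And>k::int. a \<noteq> - (q powi k)"
  shows "mock_diff q a = 0"
proof -
  \<comment> \<open>Replacing accidental values by limits makes the function analytic and its shift
    equation valid at every nonzero point, while nothing changes at a generic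
    \<open>a\<close>.\<close>
  let ?f = "remove_sings (mock_diff q)"
  have "?f a = 0"
  proof (rule shift_equation_imp_zero[OF norm_nome_square[OF q] _ _ assms(1)])
    show "?f analytic_on - {0}"
      unfolding analytic_on_analytic_at[of _ "- {0}"]
      using mock_diff_limit mock_diff_isolated by (metis ComplD remove_sings_analytic_at singletonI)
    show "?f (q\<^sup>2 * z) = - z * ?f z" if z: "z \<noteq> 0" for z
    proof -
      obtain c where c: "mock_diff q \<midarrow>z\<rightarrow> c"
        using mock_diff_limit[OF z] by blast
      show ?thesis
        using remove_sings_eqI[OF c] remove_sings_eqI[OF mock_diff_limit_up[OF z c]] by simp
    qed
  qed
  thus ?thesis
    using mock_diff_analytic[OF assms] by simp
qed

end

theorem theorem4p3:
  fixes q a :: complex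
  assumes q: "0 < norm q" "norm q < 1"
    and a_nonzero: "a \<noteq> 0"
    and a_generic: "\<And>k::int. a \<noteq> - (q powi k)"
  shows "(1 + 1 / a) *
           (\<Sum>n. qpoch (a * q) (q\<^sup>2) n * qpoch (q / a) (q\<^sup>2) n * q ^ (2 * n + 1)
                  / qpoch (- q) q (2 * n + 1))
         = 2 * appell_lerch_m a (q\<^sup>2) (-1)
           - theta_j (a * q) (q\<^sup>2) / theta_j (- q) (q ^ 4) * appell_lerch_m a q (-1)
           - 1 / 2 * (J q 1 ^ 5 / J q 2 ^ 4) * (theta_j (a * q) (q\<^sup>2) / theta_j (- a) q)"
  using mock_diff_eq_0[OF q a_nonzero a_generic]
  unfolding mock_diff_def mock_sum_def mock_rhs_def mock_term_def by simp

end
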